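(* Let $D$ be a 2-connected rooted digraph with root $r$, having $l$ special vertices and $h$ non special components. Then $\max\left(\frac{l}{30},\,h-l\right)\le \mathrm{maxleaf}(D)\le l+2h$.
   Context: A rooted digraph is a loopless digraph $D$ with a distinguished vertex $r$ (the root) such that: there is no arc $(u,r)$ for any $u\in V(D)$; there is no arc $(x,y)$ with $x\neq r$ and $y$ an outneighbour of $r$; and $r$ has outdegree at least 2. A cut of $D$ is a set $S\subseteq V(D)\setminus\{r\}$ such that some vertex $z\notin S$ is not the endpoint of any directed path starting at $r$ in $D-S$; $D$ is 2-connected if it has no cut of size at most 1. An arc $(u,v)$ is simple if $(v,u)$ is not an arc of $D$. A vertex is special if it has indegree at least 3 or has a simple in-arc. A non special vertex is a vertex $u$ which has exactly two in-neighbours, both of which are also outneighbours of $u$. The non special components of $D$ are the connected components of the subdigraph of $D$ induced by the non special vertices. An outbranching of $D$ is a spanning subdigraph which is a directed tree rooted at $r$ with all arcs directed away from $r$; its leaves are its vertices of outdegree 0; $\mathrm{maxleaf}(D)$ is the maximum number of leaves of an outbranching of $D$. *)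

theory Defs
  imports Complex_Main
begin

text \<open>A finite digraph is given by a vertex set V and an arc set A \<subseteq> V \<times> V.\<close>

definition out_nbrs :: "('a \<times> 'a) set \<Rightarrow> 'a \<Rightarrow> 'a set" where
  "out_nbrs A u = {v. (u, v) \<in> A}"

definition in_nbrs :: "('a \<times> 'a) set \<Rightarrow> 'a \<Rightarrow> 'a set" where
  "in_nbrs A v = {u. (u, v) \<in> A}"

definition rooted_digraph :: "'a set \<Rightarrow> ('a \<times> 'a) set \<Rightarrow> 'a \<Rightarrow> bool" where
  "rooted_digraph V A r \<longleftrightarrow>
     finite V \<and> A \<subseteq> V \<times> V \<and> r \<in> V \<and>
     (\<forall>u. (u, u) \<notin> A) \<and>
     (\<forall>u. (u, r) \<notin> A) \<and>
     (\<forall>x y. (x, y) \<in> A \<and> x \<noteq> r \<longrightarrow> y \<notin> out_nbrs A r) \<and>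
     card (out_nbrs A r) \<ge> 2"

text \<open>Arcs of D - S (the subdigraph induced by V - S).\<close>
definition del_arcs :: "'a set \<Rightarrow> ('a \<times> 'a) set \<Rightarrow> 'a set \<Rightarrow> ('a \<times> 'a) set" where
  "del_arcs V A S = A \<inter> ((V - S) \<times> (V - S))"

definition is_cut :: "'a set \<Rightarrow> ('a \<times> 'a) set \<Rightarrow> 'a \<Rightarrow> 'a set \<Rightarrow> bool" where
  "is_cut V A r S \<longleftrightarrow> S \<subseteq> V - {r} \<and>
     (\<exists>z \<in> V - S. (r, z) \<notin> (del_arcs V A S)\<^sup>*)"

definition two_connected :: "'a set \<Rightarrow> ('a \<times> 'a) set \<Rightarrow> 'a \<Rightarrow> bool" where
  "two_connected V A r \<longleftrightarrow> (\<forall>S. is_cut V A r S \<longrightarrow> card S \<ge> 2)"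

definition simple_arc :: "('a \<times> 'a) set \<Rightarrow> 'a \<times> 'a \<Rightarrow> bool" where
  "simple_arc A e \<longleftrightarrow> e \<in> A \<and> (snd e, fst e) \<notin> A"

definition special :: "'a set \<Rightarrow> ('a \<times> 'a) set \<Rightarrow> 'a \<Rightarrow> bool" where
  "special V A v \<longleftrightarrow> v \<in> V \<and>
     (card (in_nbrs A v) \<ge> 3 \<or> (\<exists>u. simple_arc A (u, v)))"

definition non_special :: "'a set \<Rightarrow> ('a \<times> 'a) set \<Rightarrow> 'a \<Rightarrow> bool" where
  "non_special V A v \<longleftrightarrow> v \<in> V \<and> card (in_nbrs A v) = 2 \<and>
     in_nbrs A v \<subseteq> out_nbrs A v"

definition special_vertices :: "'a set \<Rightarrow> ('a \<times> 'a) set \<Rightarrow> 'a set" where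
  "special_vertices V A = {v. special V A v}"

definition non_special_vertices :: "'a set \<Rightarrow> ('a \<times> 'a) set \<Rightarrow> 'a set" where
  "non_special_vertices V A = {v. non_special V A v}"

text \<open>Connected components (of the underlying undirected graph) of the subdigraph
  induced by the non special vertices.\<close>
definition non_special_components :: "'a set \<Rightarrow> ('a \<times> 'a) set \<Rightarrow> 'a set set" where
  "non_special_components V A =
    (let N = non_special_vertices V A;
         E = A \<inter> (N \<times> N)
     in {C. \<exists>v \<in> N. C = {w \<in> N. (v, w) \<in> (E \<union> E\<inverse>)\<^sup>*}})"

text \<open>Outbranching: spanning subdigraph which is a directed tree rooted at r with all arcs
  directed away from r: every vertex other than r has exactly one in-arc, r has none,
  and every vertex is reachable from r.\<close>
definition outbranching :: "'a set \<Rightarrow> ('a \<times> 'a) set \<Rightarrow> 'a \<Rightarrow> ('a \<times> 'a) set \<Rightarrow> bool" where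
  "outbranching V A r T \<longleftrightarrow> T \<subseteq> A \<and>
     (\<forall>v \<in> V - {r}. \<exists>!u. (u, v) \<in> T) \<and>
     (\<forall>u. (u, r) \<notin> T) \<and>
     (\<forall>v \<in> V. (r, v) \<in> T\<^sup>*)"

definition leaves :: "'a set \<Rightarrow> ('a \<times> 'a) set \<Rightarrow> 'a set" where
  "leaves V T = {v \<in> V. out_nbrs T v = {}}"

definition maxleaf :: "'a set \<Rightarrow> ('a \<times> 'a) set \<Rightarrow> 'a \<Rightarrow> nat" where
  "maxleaf V A r = Max {card (leaves V T) | T. outbranching V A r T}"

end

theory Submission
  imports Defs
begin

text \<open>A 2-connected rooted digraph has a numbering in which every vertex other than the out-neighbours
  of the root has an in-neighbour before it and one after it; this gives a forward outbranching F and
  a backward outbranching B. An acyclic spanning subdigraph with k vertices of indegree at least 2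
  has an outbranching with at least k/3 leaves (choose the inner vertices as a small hitting set of
  the in-neighbourhoods). Adding to a tree all arcs that agree with one of its two depth-first
  preorders gives such subdigraphs, so only O(maxleaf) vertices are heads of cross arcs of F or B.
  All other special vertices lie, up to O(maxleaf) of them, next to such a head.

  Non special components are bidirected paths entered by exactly two arcs, so an outbranching has at
  most two leaves in each; and a component without leaf has a vertex whose child is special.\<close>

section \<open>Dominators and numberings\<close>

text \<open>Two-connectivity leaves no dominators, and \<open>y \<notin> reach E r a\<close> encodes
  that \<open>a\<close> dominates \<open>y\<close>. The numbering is built by induction on the
  number of vertices; the obstacle is to find a vertex whose removal creates no dominator. Once
  every vertex keeps only two in-arcs, averaging yields a vertex of out-degree at most one. It is
  deleted, or bypassed by an arc from one of its in-neighbours to its only child, and put back later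
  at a suitable real value. Hence the thinning to in-degree two. Both F and B are needed because an
  arc outside both, whose head is a cross head of neither, would make its head an ancestor of its
  tail in both, although numbers rise along F and fall along B. With m for \<open>maxleaf\<close>,
  the special vertices split into at most m children of the root, 6m cross heads of each tree (3
  from the hitting set, times two preorders) and 7m heads of simple parent arcs for each direction:
  27m in all, so 30 leaves slack.\<close>

inductive_set reach :: "('a \<times> 'a) set \<Rightarrow> 'a \<Rightarrow> 'a \<Rightarrow> 'a set"
  for E :: "('a \<times> 'a) set" and r a :: 'a where
  root: "r \<in> reach E r a"
| step: "u \<in> reach E r a \<Longrightarrow> (u, v) \<in> E \<Longrightarrow> v \<noteq> a \<Longrightarrow> v \<in> reach E r a"

lemma not_in_reach_self: "a \<noteq> r \<Longrightarrow> a \<notin> reach E r a"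
  by (blast elim: reach.cases)

text \<open>Contrapositively, the dominators of a reachable vertex form a chain. The walk to
  \<open>y\<close> avoids both \<open>a\<close> and \<open>a'\<close> until it meets one of them,
  and there a walk that avoids the other takes over.\<close>

lemma dominators_chain:
  assumes "y \<in> reach E r c" "a \<in> reach E r a'" "a' \<in> reach E r a"
  shows "y \<in> reach E r a \<or> y \<in> reach E r a'"
  using assms(1)
proof induction
  case root show ?case by (blast intro: reach.root)
next
  case (step u v)
  then show ?case using assms(2,3) by (metis reach.step)
qed

text \<open>A walk around \<open>a\<close> cannot meet \<open>c\<close>, because it would then reach
  \<open>c\<close> around \<open>a\<close>. Contrapositively, domination is transitive.\<close>

lemma dominators_trans:
  assumes "y \<in> reach E r a" "c \<notin> reach E r a"
  shows "y \<in> reach E r c"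
  using assms(1)
proof induction
  case root show ?case by (rule reach.root)
next
  case (step u v)
  then have "v \<in> reach E r a" by (blast intro: reach.step)
  then show ?case using assms(2) step by (metis reach.step)
qed

text \<open>The instance \<open>a = r\<close> is plain reachability from \<open>r\<close>.\<close>

definition no_dominator :: "'a set \<Rightarrow> ('a \<times> 'a) set \<Rightarrow> 'a \<Rightarrow> bool" where
  "no_dominator W E r \<longleftrightarrow> (\<forall>a. \<forall>z\<in>W. z \<noteq> a \<longrightarrow> z \<in> reach E r a)"

section \<open>Thinning to in-degree two\<close>

abbreviation drop_in :: "('a \<times> 'a) set \<Rightarrow> 'a \<Rightarrow> ('a \<times> 'a) set" where
  "drop_in E z \<equiv> {e \<in> E. snd e \<noteq> z}"

lemma not_in_reach_drop_in: "z \<noteq> r \<Longrightarrow> z \<notin> reach (drop_in E z) r a"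
  by (auto elim: reach.cases)

lemma reach_drop_in_avoid: "y \<in> reach (drop_in E z) r a \<Longrightarrow> y \<in> reach (drop_in E z) r z"
  by (induction rule: reach.induct) (auto intro: reach.intros)

text \<open>A walk is cut at its first arrival at \<open>z\<close>; the part before uses no arc into
  \<open>z\<close>. Domination of \<open>z\<close> can thus be studied in a digraph that does not
  change when in-arcs of \<open>z\<close> are dropped.\<close>

lemma first_entry:
  assumes "z \<in> reach E r a" "z \<noteq> r"
  obtains y where "(y, z) \<in> E" "y \<in> reach (drop_in E z) r a"
proof -
  have "x \<in> reach (drop_in E z) r a \<or> (\<exists>y. (y, z) \<in> E \<and> y \<in> reach (drop_in E z) r a)"
    if "x \<in> reach E r a" for x
    using that
  proof induction
    case root show ?case by (blast intro: reach.root)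
  next
    case (step u v)
    then show ?case by (cases "v = z") (auto intro: reach.step)
  qed
  from this[OF assms(1)] show ?thesis
    using that not_in_reach_drop_in[OF assms(2)] by blast
qed

lemma finite_reach: "finite E \<Longrightarrow> finite (reach E r a)"
proof (rule finite_subset)
  show "reach E r a \<subseteq> insert r (snd ` E)"
    by (rule subsetI, erule reach.cases) force+
qed simp

text \<open>The two kept in-neighbours lie below different children of the root in the dominator tree
  of the digraph without the arcs into that vertex.\<close>
lemma two_in_arcs_suffice:
  assumes nd: "no_dominator W E r" and z: "z \<in> W" "r \<notin> W" and fin: "finite E"
  obtains p q where "(p, z) \<in> E" "(q, z) \<in> E"
    "no_dominator W (drop_in E z \<union> {(p, z), (q, z)}) r"
    "(r, z) \<in> E \<Longrightarrow> p = r \<and> q = r"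
proof -
  define H where "H = drop_in E z"
  have zr: "z \<noteq> r" using z by blast
  have finH: "finite H" using fin by (simp add: H_def)
  \<comment> \<open>It suffices that no vertex other than \<open>z\<close> dominates both kept
    in-neighbours in \<open>H\<close>: \<open>z\<close> is then still reachable around each such
    vertex, and every walk through \<open>z\<close> can be repaired.\<close>
  have keep: "no_dominator W (H \<union> {(p, z), (q, z)}) r"
    if pq: "\<And>a. a \<noteq> z \<Longrightarrow> p \<in> reach H r a \<or> q \<in> reach H r a" for p q
  proof -
    let ?E = "H \<union> {(p, z), (q, z)}"
    have mono: "x \<in> reach ?E r a" if "x \<in> reach H r a" for x a
      using that by induction (auto intro: reach.intros)
    have zE: "z \<in> reach ?E r a" if "a \<noteq> z" for a
      using pq[OF that] mono that by (metis UnI2 insertI1 insertI2 reach.step)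
    have "x \<in> reach ?E r a" if "x \<in> reach E r a" for x a
      using that
    proof induction
      case root show ?case by (rule reach.root)
    next
      case (step u v)
      then show ?case using zE by (cases "v = z") (auto intro: reach.step simp: H_def)
    qed
    then show ?thesis using nd by (auto simp: no_dominator_def)
  qed
  show ?thesis
  proof (cases "(r, z) \<in> E")
    case True
    then show ?thesis using that[of r r] keep[of r r] by (auto simp: H_def intro: reach.root)
  next
    case False
    have "z \<in> reach E r r" using nd z zr by (auto simp: no_dominator_def)
    then obtain y1 where y1: "(y1, z) \<in> E" "y1 \<in> reach H r r"
      using zr unfolding H_def by (rule first_entry)
    have y1z: "y1 \<in> reach H r z" using y1(2) unfolding H_def by (rule reach_drop_in_avoid)
    have "y1 \<noteq> r" using False y1 by blast
    \<comment> \<open>The dominators of \<open>y1\<close> in \<open>H\<close>. The topmost one, a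
      child of the root in the dominator tree, leaves the fewest vertices reachable around it, so
      \<open>t\<close> is found by minimising that number.\<close>
    define Dm where "Dm = {a. y1 \<notin> reach H r a}"
    have "y1 \<in> Dm" using not_in_reach_self[OF \<open>y1 \<noteq> r\<close>] by (simp add: Dm_def)
    then obtain t where t: "t \<in> Dm" "\<And>c. c \<in> Dm \<Longrightarrow> card (reach H r t) \<le> card (reach H r c)"
      using ex_has_least_nat[of "\<lambda>a. a \<in> Dm" y1 "\<lambda>a. card (reach H r a)"] by blast
    have top: "c \<notin> reach H r t" if c: "c \<in> Dm" for c
    proof
      assume ct: "c \<in> reach H r t"
      have "t \<notin> reach H r c"
        using dominators_chain[OF y1(2), of t c] t(1) c ct by (auto simp: Dm_def)
      then have "reach H r c \<subseteq> reach H r t" by (blast intro: dominators_trans)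
      moreover have "c \<noteq> r" using c y1(2) by (auto simp: Dm_def)
      then have "c \<notin> reach H r c" by (rule not_in_reach_self)
      ultimately have "reach H r c \<subset> reach H r t" using ct by blast
      then have "card (reach H r c) < card (reach H r t)"
        by (intro psubset_card_mono finite_reach finH)
      then show False using t(2)[OF c] by simp
    qed
    have "t \<noteq> z" using t(1) y1z by (auto simp: Dm_def)
    then have "z \<in> reach E r t" using nd z by (auto simp: no_dominator_def)
    then obtain y2 where y2: "(y2, z) \<in> E" "y2 \<in> reach H r t"
      using zr unfolding H_def by (rule first_entry)
    \<comment> \<open>Every dominator \<open>a\<close> of \<open>y1\<close> is dominated by
      \<open>t\<close>, so the walk to \<open>y2\<close> around \<open>t\<close> misses
      \<open>a\<close>.\<close>
    have "y1 \<in> reach H r a \<or> y2 \<in> reach H r a" for a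
      using top[of a] dominators_trans[OF y2(2)] by (auto simp: Dm_def)
    then show ?thesis using that[of y1 y2] keep[of y1 y2] y1 y2 False by (auto simp: H_def)
  qed
qed

abbreviation arcs2 :: "'a set \<Rightarrow> ('a \<Rightarrow> 'a) \<Rightarrow> ('a \<Rightarrow> 'a) \<Rightarrow> ('a \<times> 'a) set" where
  "arcs2 W p q \<equiv> (\<lambda>v. (p v, v)) ` W \<union> (\<lambda>v. (q v, v)) ` W"

text \<open>In an arc set of least size without dominators, the reduction at \<open>v\<close> cannot
  lose an arc, so the arcs into \<open>v\<close> are already the ones that it keeps.\<close>

lemma in_degree_two_subdigraph:
  assumes "no_dominator W A r" "r \<notin> W" "finite A" "A \<subseteq> UNIV \<times> W"
  obtains p q where "arcs2 W p q \<subseteq> A" "no_dominator W (arcs2 W p q) r"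
    "\<forall>v\<in>W. p v = r \<and> q v = r \<or> p v \<noteq> r \<and> q v \<noteq> r"
proof -
  define P where "P = (\<lambda>E. E \<subseteq> A \<and> no_dominator W E r)"
  obtain E where E: "P E" "\<And>E'. P E' \<Longrightarrow> card E \<le> card E'"
    using ex_has_least_nat[of P A card] assms(1) by (auto simp: P_def)
  have EA: "E \<subseteq> A" "no_dominator W E r" "finite E"
    using E(1) assms(3) finite_subset by (auto simp: P_def)
  have "\<exists>p q. {u. (u, v) \<in> E} = {p, q} \<and> (p = r \<and> q = r \<or> p \<noteq> r \<and> q \<noteq> r)"
    if v: "v \<in> W" for v
  proof -
    obtain p q where pq: "(p, v) \<in> E" "(q, v) \<in> E"
      "no_dominator W (drop_in E v \<union> {(p, v), (q, v)}) r" "(r, v) \<in> E \<Longrightarrow> p = r \<and> q = r"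
      by (rule two_in_arcs_suffice[OF EA(2) v assms(2) EA(3)]) blast
    let ?E = "drop_in E v \<union> {(p, v), (q, v)}"
    have sub: "?E \<subseteq> E" using pq by auto
    then have "P ?E" using EA(1) pq(3) unfolding P_def by blast
    then have "card E \<le> card ?E" by (rule E(2))
    then have "?E = E" using sub EA(3) card_seteq by blast
    then have "{u. (u, v) \<in> E} = {p, q}" by auto
    then show ?thesis using pq(1,2,4) by blast
  qed
  then obtain p q where pq: "\<And>v. v \<in> W \<Longrightarrow> {u. (u, v) \<in> E} = {p v, q v} \<and>
      (p v = r \<and> q v = r \<or> p v \<noteq> r \<and> q v \<noteq> r)"
    by metis
  have "(u, v) \<in> E \<longleftrightarrow> v \<in> W \<and> (u = p v \<or> u = q v)" for u v
  proof
    assume "(u, v) \<in> E"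
    moreover from this have "v \<in> W" using EA assms(4) by blast
    ultimately show "v \<in> W \<and> (u = p v \<or> u = q v)" using pq[of v] by auto
  next
    assume "v \<in> W \<and> (u = p v \<or> u = q v)"
    then have "u \<in> {u. (u, v) \<in> E}" using pq[of v] by auto
    then show "(u, v) \<in> E" by simp
  qed
  then have "E = arcs2 W p q" by auto
  then show ?thesis using that[of p q] pq EA by auto
qed

section \<open>Directed st-numberings for in-degree two\<close>

lemma value_next_to:
  fixes F :: "real set"
  assumes "finite F" "c \<noteq> d"
  obtains e where "e \<notin> F" "c < e \<and> e < d \<or> d < e \<and> e < c" "\<And>y. y \<in> F \<Longrightarrow> y \<noteq> c \<Longrightarrow> y < e \<longleftrightarrow> y < c"
proof -
  note next_to = that
  have pos: thesis if "c < d"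
  proof -
    let ?m = "Min (insert d {y \<in> F. y > c})"
    have "c < ?m" using assms that by (subst Min_gr_iff) auto
    then obtain e where e: "c < e" "e < ?m" using dense by blast
    have lt: "e < y" if "y = d \<or> y \<in> F \<and> y > c" for y
      using e(2) assms(1) that by (subst (asm) Min_gr_iff) auto
    show ?thesis
    proof (rule next_to[of e])
      show "e \<notin> F" using lt e by blast
      show "c < e \<and> e < d \<or> d < e \<and> e < c" using lt e by blast
      show "y < e \<longleftrightarrow> y < c" if "y \<in> F" "y \<noteq> c" for y
        using lt[of y] that e by linarith
    qed
  qed
  have neg: thesis if "d < c"
  proof -
    let ?m = "Max (insert d {y \<in> F. y < c})"
    have "?m < c" using assms that by (subst Max_less_iff) auto
    then obtain e where e: "?m < e" "e < c" using dense by blast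
    have lt: "y < e" if "y = d \<or> y \<in> F \<and> y < c" for y
      using e(1) assms(1) that by (subst (asm) Max_less_iff) auto
    show ?thesis
    proof (rule next_to[of e])
      show "e \<notin> F" using lt e by blast
      show "c < e \<and> e < d \<or> d < e \<and> e < c" using lt e by blast
      show "y < e \<longleftrightarrow> y < c" if "y \<in> F" "y \<noteq> c" for y
        using lt[of y] that e by linarith
    qed
  qed
  show ?thesis using pos neg assms(2) by linarith
qed

abbreviation between :: "real \<Rightarrow> real \<Rightarrow> real \<Rightarrow> bool" where
  "between x a b \<equiv> a < x \<and> x < b \<or> b < x \<and> x < a"

text \<open>If all arcs into \<open>v\<close> from other vertices came from a single vertex other
  than \<open>r\<close>, that vertex would dominate \<open>v\<close>.\<close>

lemma no_dominator_parents:
  assumes nd: "no_dominator W (arcs2 W p q) r" and "r \<notin> W" "v \<in> W"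
    and wf: "p v = r \<and> q v = r \<or> p v \<in> W \<and> q v \<in> W"
  shows "p v \<noteq> v" "q v \<noteq> v" "p v \<noteq> r \<Longrightarrow> p v \<noteq> q v"
proof -
  let ?E = "arcs2 W p q"
  have vr: "v \<noteq> r" using assms by blast
  have *: "\<exists>y\<in>{p v, q v}. y \<noteq> v \<and> (y = a \<longrightarrow> y = r)" if "a \<noteq> v" for a
  proof -
    have "v \<in> reach ?E r a" using nd that assms by (auto simp: no_dominator_def)
    then obtain y where y: "(y, v) \<in> ?E" "y \<in> reach (drop_in ?E v) r a"
      using vr by (rule first_entry)
    have "y \<noteq> v"
    proof
      assume "y = v"
      then show False using y(2) not_in_reach_drop_in[OF vr, of ?E a] by simp
    qed
    moreover have "y = r" if "y = a"
    proof (rule ccontr)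
      assume "y \<noteq> r"
      then show False using y(2) that not_in_reach_self[of a r "drop_in ?E v"] by simp
    qed
    moreover have "y = p v \<or> y = q v" using y(1) by blast
    ultimately show ?thesis by blast
  qed
  show "p v \<noteq> v" using *[of r] *[of "q v"] wf vr assms(2) by auto
  show "q v \<noteq> v" using *[of r] *[of "p v"] wf vr assms(2) by auto
  show "p v \<noteq> r \<Longrightarrow> p v \<noteq> q v" using *[of r] *[of "p v"] wf vr assms(2) by auto
qed

text \<open>Children of the root carry \<open>r\<close> twice, so that in-arcs counted with
  multiplicity number exactly two per vertex.\<close>

definition parents_ok :: "'a set \<Rightarrow> ('a \<Rightarrow> 'a) \<Rightarrow> ('a \<Rightarrow> 'a) \<Rightarrow> 'a \<Rightarrow> bool" where
  "parents_ok W p q r \<longleftrightarrow> (\<forall>v\<in>W. p v = r \<and> q v = r \<or> p v \<in> W \<and> q v \<in> W)"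

text \<open>Real values let the induction insert a vertex between any two others.
  \<open>between\<close> leaves open which parent comes first; the parents are sorted only in
  \<open>rr_numbering_exists\<close>.\<close>

definition st_numbering :: "'a set \<Rightarrow> ('a \<Rightarrow> 'a) \<Rightarrow> ('a \<Rightarrow> 'a) \<Rightarrow> 'a \<Rightarrow> ('a \<Rightarrow> real) \<Rightarrow> bool" where
  "st_numbering W p q r \<sigma> \<longleftrightarrow> inj_on \<sigma> W \<and>
     (\<forall>v\<in>W. p v \<noteq> r \<longrightarrow> between (\<sigma> v) (\<sigma> (p v)) (\<sigma> (q v)))"

lemma st_numbering_swap: "st_numbering W p q r \<sigma> \<Longrightarrow> parents_ok W p q r \<Longrightarrow> r \<notin> W \<Longrightarrow> st_numbering W q p r \<sigma>"
  unfolding st_numbering_def parents_ok_def by metis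

text \<open>Each vertex receives two arcs, and both arcs into some vertex come from
  \<open>r\<close>; so on average fewer than two arcs leave a vertex of \<open>W\<close>.\<close>

lemma exists_low_outdegree:
  assumes fin: "finite W" and "r \<notin> W" "W \<noteq> {}" and ok: "parents_ok W p q r"
    and nd: "no_dominator W (arcs2 W p q) r"
  obtains v where "v \<in> W" "card {x\<in>W. p x = v} + card {x\<in>W. q x = v} \<le> 1"
proof -
  obtain z where z: "z \<in> W" using assms by blast
  have "z \<in> reach (arcs2 W p q) r r" using nd z assms(2) by (auto simp: no_dominator_def)
  moreover have "x = r" if "x \<in> reach (arcs2 W p q) r r" "\<forall>x\<in>W. p x \<noteq> r" for x
    using that(1)
  proof induction
    case (step u v)
    then show ?case using that(2) ok assms(2) unfolding parents_ok_def by auto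
  qed simp
  ultimately obtain x where x: "x \<in> W" "p x = r" using z assms(2) by blast
  have count: "(\<Sum>v\<in>W. card {x\<in>W. f x = v}) < card W" if "f x = r" for f :: "'a \<Rightarrow> 'a"
  proof -
    have "(\<Sum>v\<in>W. card {x\<in>W. f x = v}) = card (\<Union>v\<in>W. {x\<in>W. f x = v})"
      using fin by (subst card_UN_disjoint) auto
    also have "\<dots> < card W"
      using fin x(1) that assms(2) by (intro psubset_card_mono) auto
    finally show ?thesis .
  qed
  have "q x = r" using x ok assms(2) unfolding parents_ok_def by auto
  then have "(\<Sum>v\<in>W. card {x\<in>W. p x = v} + card {x\<in>W. q x = v}) < (\<Sum>v\<in>W. 2)"
    using count[of p] count[of q] x by (simp add: sum.distrib)
  then obtain v where "v \<in> W" "card {x\<in>W. p x = v} + card {x\<in>W. q x = v} < 2"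
    by (meson linorder_not_le sum_mono)
  then show ?thesis using that by force
qed

text \<open>Contracting one of the two arcs into v: if both choices created a dominator of x, one
  of these two dominators would dominate both in-neighbours of v, hence v itself.\<close>
lemma bypass_vertex:
  assumes nd: "no_dominator W (arcs2 W p q) r" and rW: "r \<notin> W" and W: "v \<in> W" "x \<in> W" "x \<noteq> v"
  obtains u where "u \<in> {p v, q v}"
    "\<And>a. a \<noteq> x \<Longrightarrow> u \<in> reach (drop_in (arcs2 W p q) v) r a \<or> x \<in> reach (drop_in (arcs2 W p q) v) r a"
proof (rule ccontr)
  note bypass = that
  let ?E = "arcs2 W p q" and ?H = "drop_in (arcs2 W p q) v"
  assume "\<not> thesis"
  then have "\<exists>a. a \<noteq> x \<and> u \<notin> reach ?H r a \<and> x \<notin> reach ?H r a" if "u \<in> {p v, q v}" for u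
    using that bypass by blast
  then obtain a a' where a: "p v \<notin> reach ?H r a" "x \<notin> reach ?H r a"
    and a': "q v \<notin> reach ?H r a'" "x \<notin> reach ?H r a'"
    by blast
  have vr: "v \<noteq> r" and xr: "x \<noteq> r" using W rW by auto
  have "y \<in> reach ?H r v" if "y \<in> reach ?E r v" for y
    using that by induction (auto intro: reach.intros)
  then have xv: "x \<in> reach ?H r v" using nd W by (auto simp: no_dominator_def)
  have entry: "p v \<in> reach ?H r c \<or> q v \<in> reach ?H r c" if "c \<noteq> v" for c
  proof -
    have "v \<in> reach ?E r c" using nd W that by (auto simp: no_dominator_def)
    then obtain y where "(y, v) \<in> ?E" "y \<in> reach ?H r c" using vr by (rule first_entry)
    moreover from this have "y = p v \<or> y = q v" by blast
    ultimately show ?thesis by blast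
  qed
  have "a \<noteq> v" "a' \<noteq> v" using xv a a' by auto
  moreover have "a \<notin> reach ?H r a' \<or> a' \<notin> reach ?H r a"
    using dominators_chain[OF xv, of a a'] a a' by blast
  moreover have "p v \<notin> reach ?H r a'" if "a \<notin> reach ?H r a'"
    using dominators_trans[OF _ that] a(1) by blast
  moreover have "q v \<notin> reach ?H r a" if "a' \<notin> reach ?H r a"
    using dominators_trans[OF _ that] a'(1) by blast
  ultimately show False using entry a a' by blast
qed

text \<open>A vertex that is nobody's parent constrains no other vertex, so it can be placed last,
  at any free value between its parents.\<close>

lemma st_numbering_remove_leaf:
  assumes IH: "\<And>p q. parents_ok (W - {v}) p q r \<Longrightarrow> no_dominator (W - {v}) (arcs2 (W - {v}) p q) r
      \<Longrightarrow> \<exists>\<sigma>. st_numbering (W - {v}) p q r \<sigma>"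
    and fin: "finite W" and rW: "r \<notin> W" and ok: "parents_ok W p q r"
    and nd: "no_dominator W (arcs2 W p q) r"
    and v: "v \<in> W" "\<forall>x\<in>W. p x \<noteq> v \<and> q x \<noteq> v"
  shows "\<exists>\<sigma>. st_numbering W p q r \<sigma>"
proof -
  let ?W = "W - {v}"
  have ok': "parents_ok ?W p q r" using ok v unfolding parents_ok_def by auto
  have "z \<in> reach (arcs2 ?W p q) r a" if "z \<in> reach (arcs2 W p q) r a" "z \<noteq> v" for z a
    using that
  proof induction
    case root show ?case by (rule reach.root)
  next
    case (step s t)
    then have "s \<noteq> v" using v by auto
    then show ?case using step by (auto intro!: reach.step[of s])
  qed
  then have "no_dominator ?W (arcs2 ?W p q) r" using nd by (auto simp: no_dominator_def)
  then obtain \<sigma> where \<sigma>: "st_numbering ?W p q r \<sigma>" using IH ok' by blast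
  have "\<exists>e. e \<notin> \<sigma> ` ?W \<and> (p v \<noteq> r \<longrightarrow> between e (\<sigma> (p v)) (\<sigma> (q v)))"
  proof (cases "p v = r")
    case True
    then show ?thesis using ex_new_if_finite[of "\<sigma> ` ?W"] fin infinite_UNIV_char_0 by auto
  next
    case False
    note par = no_dominator_parents[OF nd rW v(1)]
    have pq: "p v \<in> W" "q v \<in> W" using False ok v by (auto simp: parents_ok_def)
    then have "p v \<in> ?W" "q v \<in> ?W" "p v \<noteq> q v" using par False by auto
    then have "\<sigma> (p v) \<noteq> \<sigma> (q v)" using \<sigma> by (auto simp: st_numbering_def dest: inj_onD)
    then show ?thesis using value_next_to[of "\<sigma> ` ?W"] fin by (metis finite_Diff finite_imageI)
  qed
  then obtain e where e: "e \<notin> \<sigma> ` ?W" "p v \<noteq> r \<longrightarrow> between e (\<sigma> (p v)) (\<sigma> (q v))" by blast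
  have inj: "inj_on (\<sigma>(v := e)) W"
    using \<sigma> e(1) unfolding st_numbering_def inj_on_def by auto
  have "between ((\<sigma>(v := e)) t) ((\<sigma>(v := e)) (p t)) ((\<sigma>(v := e)) (q t))" if "t \<in> W" "p t \<noteq> r" for t
    using \<sigma> e(2) that v(2) unfolding st_numbering_def by (cases "t = v") auto
  then show ?thesis using inj unfolding st_numbering_def by blast
qed

text \<open>The vertex \<open>v\<close> is bypassed: \<open>x\<close> takes a parent
  \<open>u\<close> of \<open>v\<close> in place of \<open>v\<close>. Afterwards \<open>v\<close> is
  put so near to \<open>u\<close>, or at an end of the range if \<open>u = r\<close>, that
  \<open>x\<close> still lies between \<open>v\<close> and \<open>q x\<close>.\<close>

lemma st_numbering_remove_child:
  assumes IH: "\<And>p q. parents_ok (W - {v}) p q r \<Longrightarrow> no_dominator (W - {v}) (arcs2 (W - {v}) p q) r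
      \<Longrightarrow> \<exists>\<sigma>. st_numbering (W - {v}) p q r \<sigma>"
    and fin: "finite W" and rW: "r \<notin> W" and ok: "parents_ok W p q r"
    and nd: "no_dominator W (arcs2 W p q) r"
    and v: "v \<in> W" and x: "x \<in> W" "p x = v" "\<forall>y\<in>W. q y \<noteq> v \<and> (p y = v \<longrightarrow> y = x)"
  shows "\<exists>\<sigma>. st_numbering W p q r \<sigma>"
proof -
  let ?W = "W - {v}" and ?E = "arcs2 W p q" and ?H = "drop_in (arcs2 W p q) v"
  have vr: "v \<noteq> r" using v rW by auto
  have wfv: "p v = r \<and> q v = r \<or> p v \<in> W \<and> q v \<in> W" using ok v by (auto simp: parents_ok_def)
  note par = no_dominator_parents[OF nd rW v wfv]
  have xv: "x \<noteq> v" using x(2) par(1) by metis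
  have qx: "q x \<in> W" "q x \<noteq> v" using ok x vr unfolding parents_ok_def by blast+
  obtain u where u: "u \<in> {p v, q v}" "\<And>a. a \<noteq> x \<Longrightarrow> u \<in> reach ?H r a \<or> x \<in> reach ?H r a"
    by (rule bypass_vertex[OF nd rW v x(1) xv]) blast
  define p' where "p' = p(x := u)"
  \<comment> \<open>If \<open>x\<close> becomes a child of \<open>r\<close>, its other in-arc is
    replaced too, as \<open>parents_ok\<close> demands. No dominator of \<open>x\<close> arises,
    since the arc from \<open>r\<close> reaches \<open>x\<close> around every other vertex.\<close>
  define q' where "q' = q(x := if u = r then r else q x)"
  let ?E' = "arcs2 ?W p' q'"
  have uv: "u \<noteq> v" using u(1) par(1,2) by fastforce
  have uW: "u = r \<or> u \<in> ?W" using u wfv uv by auto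
  have ok': "parents_ok ?W p' q' r"
    unfolding parents_ok_def
  proof
    fix t assume t: "t \<in> ?W"
    show "p' t = r \<and> q' t = r \<or> p' t \<in> ?W \<and> q' t \<in> ?W"
    proof (cases "t = x")
      case True
      then show ?thesis using uW qx by (auto simp: p'_def q'_def)
    next
      case False
      then have "p t \<noteq> v" "q t \<noteq> v" using x t by blast+
      then show ?thesis using False ok t by (auto simp: p'_def q'_def parents_ok_def)
    qed
  qed
  have arc: "(s, t) \<in> ?E'" if "(s, t) \<in> ?E" "t \<noteq> v" "t \<noteq> x" for s t
  proof -
    have t: "t \<in> W" "s = p t \<or> s = q t" using that(1) by blast+
    then have "s = p' t \<or> s = q' t" using that(3) by (simp add: p'_def q'_def)
    then show ?thesis using t(1) that(2) by blast
  qed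
  have xW: "x \<in> ?W" using x(1) xv by blast
  have arc_u: "(u, x) \<in> ?E'" by (rule UnI1, rule image_eqI[OF _ xW]) (simp add: p'_def)
  have arc_q: "(q x, x) \<in> ?E'" if "u \<noteq> r"
    using that by (intro UnI2, intro image_eqI[OF _ xW]) (simp add: q'_def)
  have HE': "t \<in> reach ?E' r a" if "t \<in> reach ?H r a" for t a
    using that
  proof induction
    case root show ?case by (rule reach.root)
  next
    case (step s t)
    have st: "(s, t) \<in> ?E" "t \<noteq> v" using step by auto
    have "s \<noteq> v" using step(1) not_in_reach_drop_in[OF vr, of ?E a] by auto
    show ?case
    proof (cases "t = x")
      case True
      then have "s = p x \<or> s = q x" using st(1) by blast
      then have "s = q x" using \<open>s \<noteq> v\<close> x(2) by blast
      show ?thesis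
      proof (cases "u = r")
        case True
        then show ?thesis using reach.step[OF reach.root, of r x ?E' a] arc_u step \<open>t = x\<close> by simp
      next
        case False
        then show ?thesis using reach.step[of s ?E' r a x] arc_q step \<open>t = x\<close> \<open>s = q x\<close> by simp
      qed
    next
      case False
      then show ?thesis using reach.step[of s ?E' r a t] arc[OF st] step by blast
    qed
  qed
  have xE': "x \<in> reach ?E' r a" if "a \<noteq> x" for a
    using u(2)[OF that] HE' reach.step[OF _ arc_u, of r a] that by blast
  have EE': "t \<in> reach ?E' r a" if "t \<in> reach ?E r a" "t \<noteq> v" for t a
    using that
  proof induction
    case root show ?case by (rule reach.root)
  next
    case (step s t)
    show ?case
    proof (cases "t = x")
      case True
      then show ?thesis using xE'[of a] step by simp
    next
      case False
      have "s = p t \<or> s = q t" "t \<in> W" using step(2) by blast+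
      then have "s \<noteq> v" using False x(3) by blast
      then show ?thesis using reach.step[OF _ arc[OF step(2) \<open>t \<noteq> v\<close> False]] step by blast
    qed
  qed
  have "no_dominator ?W ?E' r"
    unfolding no_dominator_def using EE' nd by (auto simp: no_dominator_def)
  then obtain \<sigma> where \<sigma>: "st_numbering ?W p' q' r \<sigma>" using IH ok' by blast
  have inj: "inj_on \<sigma> ?W" and \<sigma>b: "\<And>t. t \<in> ?W \<Longrightarrow> p' t \<noteq> r \<Longrightarrow> between (\<sigma> t) (\<sigma> (p' t)) (\<sigma> (q' t))"
    using \<sigma> by (auto simp: st_numbering_def)
  have qxx: "\<sigma> (q x) \<noteq> \<sigma> x"
  proof -
    have "p x = r \<and> q x = r \<or> p x \<in> W \<and> q x \<in> W" using ok x(1) unfolding parents_ok_def by blast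
    then have "q x \<noteq> x" using no_dominator_parents[OF nd rW x(1)] by blast
    then show ?thesis using inj_onD[OF inj, of "q x" x] qx xW by auto
  qed
  have "\<exists>e. e \<notin> \<sigma> ` ?W \<and> (p v \<noteq> r \<longrightarrow> between e (\<sigma> (p v)) (\<sigma> (q v))) \<and> between (\<sigma> x) e (\<sigma> (q x))"
  proof (cases "u = r")
    case True
    then have pv: "p v = r" using u(1) wfv rW by auto
    let ?F = "\<sigma> ` ?W"
    have F: "finite ?F" "?F \<noteq> {}" using fin xW by blast+
    have xF: "\<sigma> x \<in> ?F" "\<sigma> (q x) \<in> ?F" using xW qx by blast+
    \<comment> \<open>Here \<open>v\<close> is a child of the root and its own position is free, so
      it goes beyond all values, at the end that leaves \<open>x\<close> between \<open>v\<close>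
      and \<open>q x\<close>.\<close>
    show ?thesis
    proof (cases "\<sigma> (q x) < \<sigma> x")
      case True
      have "y < Max ?F + 1" if "y \<in> ?F" for y using Max_ge[OF F(1) that] by simp
      then show ?thesis using True xF pv by (intro exI[of _ "Max ?F + 1"]) force
    next
      case False
      have "y > Min ?F - 1" if "y \<in> ?F" for y using Min_le[OF F(1) that] by simp
      then show ?thesis using False qxx xF pv by (intro exI[of _ "Min ?F - 1"]) force
    qed
  next
    case False
    then have pvr: "p v \<noteq> r" using u(1) wfv rW by auto
    define w where "w = (if u = p v then q v else p v)"
    have "u \<in> ?W" "w \<in> ?W" "u \<noteq> w" using pvr u(1) wfv rW par by (auto simp: w_def)
    then have ne: "\<sigma> u \<noteq> \<sigma> w" using inj_onD[OF inj] by blast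
    \<comment> \<open>Right beside \<open>\<sigma> u\<close>, on the side of the other parent
      \<open>w\<close>: this lies between the parents of \<open>v\<close>, and every value except
      \<open>\<sigma> u\<close> compares with \<open>e\<close> as it does with
      \<open>\<sigma> u\<close>, so \<open>x\<close> sees \<open>v\<close> where it saw
      \<open>u\<close>.\<close>
    obtain e where e: "e \<notin> \<sigma> ` ?W" "between e (\<sigma> u) (\<sigma> w)"
      "\<And>y. y \<in> \<sigma> ` ?W \<Longrightarrow> y \<noteq> \<sigma> u \<Longrightarrow> y < e \<longleftrightarrow> y < \<sigma> u"
      using value_next_to[OF _ ne, of "\<sigma> ` ?W"] fin by (metis finite_Diff finite_imageI)
    have bx: "between (\<sigma> x) (\<sigma> u) (\<sigma> (q x))"
      using \<sigma>b[OF xW] False by (simp add: p'_def q'_def)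
    have "\<sigma> x \<in> \<sigma> ` ?W" using xW by blast
    then have "\<sigma> x < e \<longleftrightarrow> \<sigma> x < \<sigma> u" "\<sigma> x \<noteq> e" using e(1) e(3)[of "\<sigma> x"] bx by auto
    then have "between (\<sigma> x) e (\<sigma> (q x))" using bx by linarith
    moreover have "between e (\<sigma> (p v)) (\<sigma> (q v))"
      using e(2) u(1) by (auto simp: w_def split: if_splits)
    ultimately show ?thesis using e(1) by blast
  qed
  then obtain e where e: "e \<notin> \<sigma> ` ?W" "p v \<noteq> r \<longrightarrow> between e (\<sigma> (p v)) (\<sigma> (q v))"
    "between (\<sigma> x) e (\<sigma> (q x))" by blast
  have inj': "inj_on (\<sigma>(v := e)) W"
    using inj e(1) unfolding inj_on_def by auto
  have "between ((\<sigma>(v := e)) t) ((\<sigma>(v := e)) (p t)) ((\<sigma>(v := e)) (q t))" if t: "t \<in> W" "p t \<noteq> r" for t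
  proof -
    consider "t = v" | "t = x" | "t \<noteq> v" "t \<noteq> x" by blast
    then show ?thesis
    proof cases
      case 1
      then show ?thesis using e(2) t par by simp
    next
      case 2
      then show ?thesis using e(3) x(2) xv qx by simp
    next
      case 3
      then have "p t \<noteq> v" "q t \<noteq> v" using x t by blast+
      then show ?thesis using \<sigma>b[of t] 3 t by (simp add: p'_def q'_def)
    qed
  qed
  then show ?thesis using inj' unfolding st_numbering_def by blast
qed

theorem st_numbering_exists:
  assumes "finite W" "r \<notin> W" "parents_ok W p q r" "no_dominator W (arcs2 W p q) r"
  shows "\<exists>\<sigma>. st_numbering W p q r \<sigma>"
  using assms
proof (induction "card W" arbitrary: W p q rule: less_induct)
  case less
  show ?case
  proof (cases "W = {}")
    case True
    then show ?thesis by (auto simp: st_numbering_def)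
  next
    case False
    obtain v where v: "v \<in> W" "card {x\<in>W. p x = v} + card {x\<in>W. q x = v} \<le> 1"
      using exists_low_outdegree[OF less(2,3) False less(4,5)] by metis
    have IH: "\<exists>\<sigma>. st_numbering (W - {v}) p q r \<sigma>"
      if "parents_ok (W - {v}) p q r" "no_dominator (W - {v}) (arcs2 (W - {v}) p q) r" for p q
      using less(1)[OF card_Diff1_less[OF less(2) v(1)]] less(2,3) that by blast
    have fin: "finite {x\<in>W. f x = v}" for f :: "'a \<Rightarrow> 'a" using less(2) by simp
    consider "{x\<in>W. p x = v} = {}" "{x\<in>W. q x = v} = {}"
      | x where "{x\<in>W. p x = v} = {x}" "{x\<in>W. q x = v} = {}"
      | x where "{x\<in>W. p x = v} = {}" "{x\<in>W. q x = v} = {x}"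
    proof (cases "{x\<in>W. p x = v} = {}")
      case True
      then have "card {x\<in>W. q x = v} \<le> 1" using v(2) by linarith
      then have "{x\<in>W. q x = v} = {} \<or> (\<exists>x. {x\<in>W. q x = v} = {x})"
        using fin[of q] by (metis card_1_singletonE card_0_eq le_neq_implies_less less_one)
      then show ?thesis using True that(1,3) by blast
    next
      case False
      then have "card {x\<in>W. p x = v} > 0" using fin[of p] unfolding card_gt_0_iff by (rule conjI)
      then have "card {x\<in>W. p x = v} = 1" "card {x\<in>W. q x = v} = 0" using v(2) by linarith+
      then have "\<exists>x. {x\<in>W. p x = v} = {x}" "{x\<in>W. q x = v} = {}"
        using card_1_singletonE[of "{x\<in>W. p x = v}"] card_0_eq[OF fin[of q]] by blast+
      then show ?thesis using that(2) by blast
    qed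
    then show ?thesis
    proof cases
      case 1
      then show ?thesis
        by (intro st_numbering_remove_leaf[OF IH less(2-5) v(1)]) auto
    next
      case (2 x)
      then show ?thesis
        by (intro st_numbering_remove_child[OF IH less(2-5) v(1), of x]) auto
    next
      case (3 x)
      \<comment> \<open>The only child has \<open>v\<close> as its \<open>q\<close>-parent, so
        \<open>p\<close> and \<open>q\<close> change roles.\<close>
      have ok: "parents_ok W q p r" using less(4) by (auto simp: parents_ok_def)
      have "no_dominator W (arcs2 W q p) r" using less(5) by (simp add: Un_commute)
      then have "\<exists>\<sigma>. st_numbering W q p r \<sigma>"
        using 3 by (intro st_numbering_remove_child[OF IH less(2,3) ok _ v(1), of x]) auto
      then show ?thesis using st_numbering_swap ok less(3) by metis
    qed
  qed
qed

text \<open>The root counts as both the first and the last vertex of the numbering.\<close>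
definition rr_numbering :: "'a set \<Rightarrow> ('a \<times> 'a) set \<Rightarrow> 'a \<Rightarrow> ('a \<Rightarrow> real) \<Rightarrow> ('a \<Rightarrow> 'a) \<Rightarrow> ('a \<Rightarrow> 'a) \<Rightarrow> bool"
  where "rr_numbering V A r \<sigma> f b \<longleftrightarrow> inj_on \<sigma> (V - {r}) \<and>
    (\<forall>v\<in>V - {r}. (f v, v) \<in> A \<and> (b v, v) \<in> A \<and>
      (if (r, v) \<in> A then f v = r \<and> b v = r
       else f v \<in> V - {r} \<and> b v \<in> V - {r} \<and> \<sigma> (f v) < \<sigma> v \<and> \<sigma> v < \<sigma> (b v)))"

theorem rr_numbering_exists:
  assumes D: "rooted_digraph V A r" and con: "two_connected V A r"
  shows "\<exists>\<sigma> f b. rr_numbering V A r \<sigma> f b"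
proof -
  let ?W = "V - {r}"
  have fin: "finite V" and AV: "A \<subseteq> V \<times> V" and rV: "r \<in> V" and nr: "\<And>u. (u, r) \<notin> A"
    and out: "\<And>x v. (x, v) \<in> A \<Longrightarrow> (r, v) \<in> A \<Longrightarrow> x = r"
    using D by (auto simp: rooted_digraph_def out_nbrs_def)
  have finA: "finite A" using fin AV finite_subset by blast
  have "z \<in> reach A r a" if z: "z \<in> ?W" "z \<noteq> a" for z a
  proof -
    \<comment> \<open>The intersection also covers \<open>a = r\<close> and \<open>a\<close> outside
      \<open>V\<close>, where it is empty; with at most one element it cannot be a cut.\<close>
    let ?S = "?W \<inter> {a}"
    have "card ?S \<le> card {a}" by (intro card_mono) auto
    then have "\<not> is_cut V A r ?S" using con by (force simp: two_connected_def)
    then have path: "(r, z) \<in> (del_arcs V A ?S)\<^sup>*"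
      using z unfolding is_cut_def by blast
    show ?thesis using path
    proof induction
      case base show ?case by (rule reach.root)
    next
      case (step x y)
      then have "(x, y) \<in> A" "y \<noteq> a" using nr by (auto simp: del_arcs_def)
      then show ?case using step by (auto intro: reach.step[of x])
    qed
  qed
  then have nd: "no_dominator ?W A r" by (simp add: no_dominator_def)
  have sub: "A \<subseteq> UNIV \<times> ?W" using AV nr by blast
  obtain p q where pq: "arcs2 ?W p q \<subseteq> A" "no_dominator ?W (arcs2 ?W p q) r"
    "\<forall>v\<in>?W. p v = r \<and> q v = r \<or> p v \<noteq> r \<and> q v \<noteq> r"
    by (rule in_degree_two_subdigraph[OF nd _ finA sub]) auto
  have arc: "(p v, v) \<in> A" "(q v, v) \<in> A" if "v \<in> ?W" for v using pq(1) that by blast+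
  have ok: "parents_ok ?W p q r"
    unfolding parents_ok_def
  proof
    fix v assume v: "v \<in> ?W"
    show "p v = r \<and> q v = r \<or> p v \<in> ?W \<and> q v \<in> ?W"
      using pq(3) arc[OF v] AV v by blast
  qed
  obtain \<sigma> where \<sigma>: "st_numbering ?W p q r \<sigma>"
    using st_numbering_exists[OF _ _ ok pq(2)] fin by auto
  have par: "if (r, v) \<in> A then p v = r \<and> q v = r else p v \<in> ?W \<and> q v \<in> ?W \<and>
      between (\<sigma> v) (\<sigma> (p v)) (\<sigma> (q v))" if v: "v \<in> ?W" for v
  proof (cases "(r, v) \<in> A")
    case True
    then show ?thesis using out arc[OF v] by simp
  next
    case False
    then have "p v \<noteq> r" using arc[OF v] by auto
    moreover from this have "p v \<in> ?W \<and> q v \<in> ?W" using ok v unfolding parents_ok_def by blast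
    ultimately show ?thesis using \<sigma> v False unfolding st_numbering_def by simp
  qed
  let ?f = "\<lambda>v. if \<sigma> (p v) < \<sigma> v then p v else q v"
  let ?b = "\<lambda>v. if \<sigma> (p v) < \<sigma> v then q v else p v"
  have "rr_numbering V A r \<sigma> ?f ?b"
    unfolding rr_numbering_def
  proof (intro conjI ballI)
    show "inj_on \<sigma> ?W" using \<sigma> by (simp add: st_numbering_def)
    fix v assume v: "v \<in> ?W"
    show "(?f v, v) \<in> A" "(?b v, v) \<in> A" using arc[OF v] by simp_all
    show "if (r, v) \<in> A then ?f v = r \<and> ?b v = r
       else ?f v \<in> ?W \<and> ?b v \<in> ?W \<and> \<sigma> (?f v) < \<sigma> v \<and> \<sigma> v < \<sigma> (?b v)"
      using par[OF v] by (auto split: if_splits)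
  qed
  then show ?thesis by blast
qed

section \<open>Leaves of outbranchings\<close>

text \<open>Greedy choice with a potential. If the sets containing some \<open>b\<close> weigh at
  least 2, taking \<open>b\<close> lowers the right side by at least 3, which pays for one element
  of \<open>X\<close>. Otherwise the sets are disjoint with at least two elements each, and one
  element per set is paid by two elements of \<open>B\<close> and weight 1.\<close>

lemma hitting_set:
  fixes I :: "'b \<Rightarrow> 'a set"
  assumes "finite W" "finite B" "\<forall>w\<in>W. I w \<subseteq> B \<and> I w \<noteq> {}"
  shows "\<exists>X\<subseteq>B. (\<forall>w\<in>W. I w \<inter> X \<noteq> {}) \<and>
    3 * card X \<le> card B + (\<Sum>w\<in>W. if card (I w) = 1 then 2 else 1)"
  using assms
proof (induction "card W" arbitrary: W B rule: less_induct)
  case less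
  let ?c = "\<lambda>w. if card (I w) = 1 then 2 else 1 :: nat"
  let ?at = "\<lambda>b. {w\<in>W. b \<in> I w}"
  show ?case
  proof (cases "\<exists>b\<in>B. sum ?c (?at b) \<ge> 2")
    case True
    then obtain b where b: "b \<in> B" "sum ?c (?at b) \<ge> 2" by blast
    have "?at b \<noteq> {}"
    proof
      assume "?at b = {}"
      then show False using b(2) by (simp only: sum.empty)
    qed
    then have "card (W - ?at b) < card W"
      using less(2) by (intro psubset_card_mono) auto
    moreover have "\<forall>w\<in>W - ?at b. I w \<subseteq> B - {b} \<and> I w \<noteq> {}" using less(4) by blast
    ultimately obtain X where X: "X \<subseteq> B - {b}" "\<forall>w\<in>W - ?at b. I w \<inter> X \<noteq> {}"
      "3 * card X \<le> card (B - {b}) + sum ?c (W - ?at b)"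
      using less(1)[of "W - ?at b" "B - {b}"] less(2,3) by auto
    have "finite X" "b \<notin> X" using X(1) less(3) finite_subset by auto
    then have "card (insert b X) = card X + 1" by simp
    moreover have "card B = card (B - {b}) + 1" using b less(3) by (metis card_Suc_Diff1 Suc_eq_plus1)
    moreover have "sum ?c W = sum ?c (W - ?at b) + sum ?c (?at b)"
      using less(2) by (intro sum.subset_diff) auto
    ultimately have "3 * card (insert b X) \<le> card B + sum ?c W" using X(3) b(2) by linarith
    moreover have "\<forall>w\<in>W. I w \<inter> insert b X \<noteq> {}" using X(2) by blast
    moreover have "insert b X \<subseteq> B" using X(1) b(1) by blast
    ultimately show ?thesis by blast
  next
    case False
    have disj: "I w \<inter> I w' = {}" if w: "w \<in> W" "w' \<in> W" "w \<noteq> w'" for w w'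
    proof (rule ccontr)
      assume "I w \<inter> I w' \<noteq> {}"
      then obtain b where b: "b \<in> I w" "b \<in> I w'" by blast
      have "sum ?c {w, w'} \<le> sum ?c (?at b)"
        using w b less(2) by (intro sum_mono2) auto
      moreover have "sum ?c {w, w'} \<ge> 2" using w(3) by simp
      ultimately have "sum ?c (?at b) \<ge> 2" by linarith
      moreover have "b \<in> B" using b w less(4) by blast
      ultimately show False using False by blast
    qed
    have two: "card (I w) \<ge> 2" if w: "w \<in> W" for w
    proof (rule ccontr)
      assume "\<not> card (I w) \<ge> 2"
      moreover have "finite (I w)" "I w \<noteq> {}" using less(3,4) w finite_subset by blast+
      then have "card (I w) > 0" by (simp add: card_gt_0_iff)
      ultimately have 1: "card (I w) = 1" by linarith
      obtain b where b: "b \<in> I w" using \<open>I w \<noteq> {}\<close> by blast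
      have "sum ?c {w} \<le> sum ?c (?at b)"
        using w b less(2) by (intro sum_mono2) auto
      then have "sum ?c (?at b) \<ge> 2" using 1 by simp
      moreover have "b \<in> B" using b w less(4) by blast
      ultimately show False using False by blast
    qed
    have "\<forall>w\<in>W. \<exists>b. b \<in> I w" using less(4) by blast
    then obtain g where g: "\<forall>w\<in>W. g w \<in> I w" by metis
    have "card W * 2 \<le> (\<Sum>w\<in>W. card (I w))"
      using sum_mono[of W "\<lambda>_. 2" "\<lambda>w. card (I w)"] two by simp
    also have "\<dots> = card (\<Union>w\<in>W. I w)"
      using less(2-4) disj finite_subset by (subst card_UN_disjoint) (blast intro: finite_subset)+
    also have "\<dots> \<le> card B" using less(3,4) by (intro card_mono) auto
    finally have "card W * 2 \<le> card B" .
    moreover have "card W \<le> sum ?c W" using sum_mono[of W "\<lambda>_. 1" ?c] by simp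
    moreover have "card (g ` W) \<le> card W" using less(2) by (rule card_image_le)
    ultimately have "3 * card (g ` W) \<le> card B + sum ?c W" by linarith
    moreover have "g ` W \<subseteq> B" "\<forall>w\<in>W. I w \<inter> g ` W \<noteq> {}" using g less(4) by blast+
    ultimately show ?thesis by blast
  qed
qed

section \<open>Outbranchings and \<open>maxleaf\<close>\<close>

lemma rooted_digraphD:
  assumes "rooted_digraph V A r"
  shows "finite V" "A \<subseteq> V \<times> V" "r \<in> V" "(u, r) \<notin> A" "(u, u) \<notin> A"
    "(r, v) \<in> A \<Longrightarrow> (x, v) \<in> A \<Longrightarrow> x = r"
  using assms by (auto simp: rooted_digraph_def out_nbrs_def)

lemma outbranchingD:
  assumes "outbranching V A r T"
  shows "T \<subseteq> A" "v \<in> V - {r} \<Longrightarrow> \<exists>u. (u, v) \<in> T" "v \<in> V \<Longrightarrow> (r, v) \<in> T\<^sup>*" "(u, r) \<notin> T"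
  using assms unfolding outbranching_def by blast+

lemma outbranching_parent_unique:
  assumes "rooted_digraph V A r" "outbranching V A r T" "(u, v) \<in> T" "(u', v) \<in> T"
  shows "u = u'"
proof -
  have "v \<in> V - {r}"
    using assms outbranchingD(1,4)[OF assms(2)] rooted_digraphD(2)[OF assms(1)] by blast
  then show ?thesis using assms(2-4) unfolding outbranching_def by blast
qed

lemma outbranching_of_parents:
  assumes D: "rooted_digraph V A r" and p: "\<And>v. v \<in> V - {r} \<Longrightarrow> (p v, v) \<in> A"
    and acyc: "acyclic ((\<lambda>v. (p v, v)) ` (V - {r}))"
  shows "outbranching V A r ((\<lambda>v. (p v, v)) ` (V - {r}))" (is "outbranching V A r ?T")
proof -
  have "finite ?T" using rooted_digraphD(1)[OF D] by simp
  then have wf: "wf ?T" using acyc finite_acyclic_wf by blast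
  have "v \<in> V \<longrightarrow> (r, v) \<in> ?T\<^sup>*" for v
    using wf
  proof (induction v rule: wf_induct_rule)
    case (less v)
    show ?case
    proof (cases "v \<in> V - {r}")
      case True
      then have arc: "(p v, v) \<in> ?T" by blast
      have "p v \<in> V" using p[OF True] rooted_digraphD(2)[OF D] by blast
      then show ?thesis using less[OF arc] arc by (meson rtrancl.rtrancl_into_rtrancl)
    qed auto
  qed
  then show ?thesis using p unfolding outbranching_def by auto
qed

lemma finite_leaf_counts:
  "rooted_digraph V A r \<Longrightarrow> finite {card (leaves V T) | T. outbranching V A r T}"
proof -
  assume D: "rooted_digraph V A r"
  have "{card (leaves V T) | T. outbranching V A r T} \<subseteq> (\<lambda>T. card (leaves V T)) ` Pow A"
    by (auto simp: outbranching_def)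
  moreover have "finite A" using rooted_digraphD(1,2)[OF D] by (meson finite_SigmaI finite_subset)
  ultimately show ?thesis by (meson finite_Pow_iff finite_imageI finite_subset)
qed

lemma leaves_le_maxleaf:
  assumes "rooted_digraph V A r" "outbranching V A r T"
  shows "card (leaves V T) \<le> maxleaf V A r"
  unfolding maxleaf_def using assms(2) by (intro Max_ge finite_leaf_counts[OF assms(1)]) auto

lemma maxleaf_attained:
  assumes "rooted_digraph V A r" "outbranching V A r T0"
  obtains T where "outbranching V A r T" "card (leaves V T) = maxleaf V A r"
proof -
  let ?S = "{card (leaves V T) | T. outbranching V A r T}"
  have "Max ?S \<in> ?S" using assms(2) by (intro Max_in finite_leaf_counts[OF assms(1)]) auto
  then obtain T where "Max ?S = card (leaves V T)" "outbranching V A r T" by auto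
  then show ?thesis using that[of T] by (simp add: maxleaf_def)
qed

text \<open>In an acyclic digraph any choice of one in-arc per vertex gives an outbranching. If all
  parents lie in a hitting set \<open>X\<close> of the in-neighbourhoods, the vertices outside
  \<open>X\<close> are leaves; with k vertices of in-degree at least two,
  \<open>3|X| \<le> 3|V| - k\<close>.\<close>

lemma acyclic_subdigraph_leaves:
  assumes D: "rooted_digraph V A r" and GA: "G \<subseteq> A" and acyc: "acyclic G"
    and cov: "\<And>v. v \<in> V - {r} \<Longrightarrow> \<exists>u. (u, v) \<in> G"
  shows "card {v \<in> V - {r}. card (in_nbrs G v) \<ge> 2} \<le> 3 * maxleaf V A r"
proof -
  let ?W = "V - {r}" and ?K = "{v \<in> V - {r}. card (in_nbrs G v) \<ge> 2}"
  note fin = rooted_digraphD(1)[OF D] and AV = rooted_digraphD(2)[OF D]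
  have finI: "finite (in_nbrs G v)" for v
    using fin AV GA finite_subset[of "in_nbrs G v" V] by (auto simp: in_nbrs_def)
  have "\<forall>v\<in>?W. in_nbrs G v \<subseteq> V \<and> in_nbrs G v \<noteq> {}"
    using cov AV GA by (auto simp: in_nbrs_def)
  then obtain X where X: "X \<subseteq> V" "\<forall>v\<in>?W. in_nbrs G v \<inter> X \<noteq> {}"
    "3 * card X \<le> card V + (\<Sum>v\<in>?W. if card (in_nbrs G v) = 1 then 2 else 1)"
    using hitting_set[of ?W V "in_nbrs G"] fin by auto
  then have "\<forall>v\<in>?W. \<exists>u. (u, v) \<in> G \<and> u \<in> X" by (auto simp: in_nbrs_def)
  then obtain p where p: "\<And>v. v \<in> ?W \<Longrightarrow> (p v, v) \<in> G \<and> p v \<in> X" by metis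
  let ?T = "(\<lambda>v. (p v, v)) ` ?W"
  have "acyclic ?T" using p acyc by (intro acyclic_subset[OF acyc]) blast
  then have T: "outbranching V A r ?T" using p GA by (intro outbranching_of_parents[OF D]) blast+
  have "V - X \<subseteq> leaves V ?T" using p by (auto simp: leaves_def out_nbrs_def)
  then have "card (V - X) \<le> card (leaves V ?T)"
    using fin by (intro card_mono) (auto simp: leaves_def)
  then have "card V - card X \<le> maxleaf V A r"
    using leaves_le_maxleaf[OF D T] X(1) fin by (simp add: card_Diff_subset finite_subset)
  moreover have "(\<Sum>v\<in>?W. if card (in_nbrs G v) = 1 then 2 else 1) + card ?K \<le> 2 * card V"
  proof -
    have "card ?K = (\<Sum>v\<in>?W. if card (in_nbrs G v) \<ge> 2 then 1 else 0)"
      unfolding card_eq_sum[of ?K] using fin by (intro sum.inter_filter) simp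
    then have "(\<Sum>v\<in>?W. if card (in_nbrs G v) = 1 then 2 else 1) + card ?K
      = (\<Sum>v\<in>?W. (if card (in_nbrs G v) = 1 then 2 else 1) + (if card (in_nbrs G v) \<ge> 2 then 1 else 0))"
      by (simp only: sum.distrib)
    also have "\<dots> \<le> (\<Sum>v\<in>?W. 2)" by (intro sum_mono) auto
    also have "\<dots> \<le> 2 * card V" using fin card_mono[of V ?W] by simp
    finally show ?thesis .
  qed
  ultimately show ?thesis using X(3) by linarith
qed

text \<open>Every inner vertex has a child of least \<open>\<sigma>\<close>, so there are at least
  as many such first children as inner vertices. The \<open>+ 1\<close> is the root, a vertex that
  is nobody's child.\<close>

lemma nonfirst_children_bound:
  fixes \<sigma> :: "'a \<Rightarrow> real"
  assumes D: "rooted_digraph V A r" and T: "outbranching V A r T"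
  shows "card {v. \<exists>u c. (u, v) \<in> T \<and> (u, c) \<in> T \<and> \<sigma> c < \<sigma> v} + 1 \<le> card (leaves V T)"
    (is "card ?S + 1 \<le> _")
proof -
  note fin = rooted_digraphD(1)[OF D] and rV = rooted_digraphD(3)[OF D]
  have TV: "T \<subseteq> V \<times> (V - {r})"
    using rooted_digraphD(2)[OF D] outbranchingD(1,4)[OF T] by blast
  let ?F = "V - {r} - ?S"
  define par where "par = (\<lambda>v. THE u. (u, v) \<in> T)"
  have par: "par v = u" if "(u, v) \<in> T" for u v
    unfolding par_def using that outbranching_parent_unique[OF D T] by blast
  have "u \<in> par ` ?F" if u: "u \<in> V - leaves V T" for u
  proof -
    let ?C = "out_nbrs T u"
    have "?C \<noteq> {}" using u by (auto simp: leaves_def)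
    moreover have "finite ?C" using fin TV finite_subset[of ?C V] by (auto simp: out_nbrs_def)
    ultimately obtain c where c: "c \<in> ?C" "\<forall>d\<in>?C. \<sigma> c \<le> \<sigma> d"
      using arg_min_if_finite[of ?C \<sigma>] by (metis linorder_not_le)
    have "(u, c) \<in> T" using c by (simp add: out_nbrs_def)
    moreover have "c \<notin> ?S"
    proof
      assume "c \<in> ?S"
      then obtain u' d where d: "(u', c) \<in> T" "(u', d) \<in> T" "\<sigma> d < \<sigma> c" by blast
      then have "u' = u" using outbranching_parent_unique[OF D T] \<open>(u, c) \<in> T\<close> by blast
      then show False using c d by (force simp: out_nbrs_def)
    qed
    ultimately show ?thesis using par TV by (intro image_eqI[of _ _ c]) auto
  qed
  then have "card (V - leaves V T) \<le> card ?F"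
    using fin by (intro surj_card_le[of ?F _ par] subsetI) simp_all
  moreover have S: "?S \<subseteq> V - {r}" using TV by blast
  have finS: "finite ?S" using S by (rule finite_subset) (use fin in simp)
  have "card ?F = card (V - {r}) - card ?S" using finS S by (rule card_Diff_subset)
  moreover have "card ?S \<le> card (V - {r})" using S by (intro card_mono) (use fin in simp)
  moreover have "card V = card (V - {r}) + 1" using card.remove[OF fin rV] by simp
  moreover have "card (V - leaves V T) = card V - card (leaves V T)"
    using fin by (intro card_Diff_subset) (auto simp: leaves_def)
  moreover have "card (leaves V T) \<le> card V" using fin by (intro card_mono) (auto simp: leaves_def)
  ultimately show ?thesis by linarith
qed

section \<open>Cross arcs\<close>

text \<open>The list omits the root, so a tree arc appends exactly one entry and ancestors
  correspond to prefixes.\<close>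

inductive tpath :: "('a \<times> 'a) set \<Rightarrow> 'a \<Rightarrow> 'a \<Rightarrow> 'a list \<Rightarrow> bool" for T r where
  root: "tpath T r r []"
| step: "tpath T r u l \<Longrightarrow> (u, v) \<in> T \<Longrightarrow> tpath T r v (l @ [v])"

lemma tpath_exists: "(r, v) \<in> T\<^sup>* \<Longrightarrow> \<exists>l. tpath T r v l"
proof (induction rule: rtrancl_induct)
  case base show ?case by (rule exI, rule tpath.root)
next
  case (step u v)
  then show ?case using tpath.step[of T r u _ v] by blast
qed

lemma tpath_unique:
  assumes D: "rooted_digraph V A r" and T: "outbranching V A r T"
    and "tpath T r v l" "tpath T r v m"
  shows "l = m"
  using assms(3,4)
proof (induction arbitrary: m)
  case root
  then show ?case using outbranchingD(4)[OF T] by (cases rule: tpath.cases) auto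
next
  case (step u l v)
  from step(4) show ?case
  proof (cases rule: tpath.cases)
    case root
    then show ?thesis using step(2) outbranchingD(4)[OF T] by simp
  next
    case (step u' l')
    have "u' = u" by (rule outbranching_parent_unique[OF D T step(3) \<open>(u, v) \<in> T\<close>])
    then show ?thesis using step(1,2) \<open>\<And>m. tpath T r u m \<Longrightarrow> l = m\<close>[of l'] by simp
  qed
qed

lemma tpath_prefix_ancestor:
  assumes "tpath T r u m" "tpath T r v l" "m = l @ zs"
  shows "(v, u) \<in> T\<^sup>*"
  using assms(1,3)
proof (induction arbitrary: zs)
  case root
  then have "l = []" by simp
  have "v = r" using assms(2) \<open>l = []\<close> by (cases rule: tpath.cases) auto
  then show ?case by simp
next
  case (step u m w)
  show ?case
  proof (cases zs rule: rev_cases)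
    case Nil
    then have "l = m @ [w]" using step by simp
    have "v = w" using assms(2) \<open>l = m @ [w]\<close> by (cases rule: tpath.cases) auto
    then show ?thesis by simp
  next
    case (snoc ys z)
    then have "(v, u) \<in> T\<^sup>*" using step by simp
    then show ?thesis using step(2) by (rule rtrancl_into_rtrancl)
  qed
qed

lemma tpath_subset: "tpath T r u l \<Longrightarrow> set l \<subseteq> snd ` T"
  by (induction rule: tpath.induct) force+

text \<open>At the first difference the injective labels decide one way or the other. Without a
  difference \<open>l\<close> is a proper prefix of \<open>m\<close>, and \<open>lexord\<close> puts
  proper prefixes first.\<close>

lemma prefix_or_lexord:
  fixes \<sigma> :: "'a \<Rightarrow> nat"
  assumes "inj_on \<sigma> (set l \<union> set m)" "\<nexists>zs. l = m @ zs"
  shows "(l, m) \<in> lexord {(x, y). \<sigma> x < \<sigma> y} \<or> (l, m) \<in> lexord {(x, y). \<sigma> x > \<sigma> y}"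
  using assms
proof (induction m arbitrary: l)
  case Nil then show ?case by simp
next
  case (Cons a m)
  show ?case
  proof (cases l)
    case Nil then show ?thesis by simp
  next
    case (Cons b k)
    show ?thesis
    proof (cases "b = a")
      case True
      have "inj_on \<sigma> (set k \<union> set m)" using Cons.prems(1) by (rule inj_on_subset) (auto simp: Cons)
      moreover have "\<nexists>zs. k = m @ zs" using Cons.prems(2) Cons True by simp
      ultimately show ?thesis using Cons.IH[of k] Cons True by simp
    next
      case False
      then have "\<sigma> b \<noteq> \<sigma> a" using inj_onD[OF Cons.prems(1), of b a] Cons by auto
      then show ?thesis using Cons by auto
    qed
  qed
qed

text \<open>The two orders are depth-first preorders of the tree, one visiting the children from left to
  right and the other from right to left.\<close>
lemma two_preorders:
  assumes D: "rooted_digraph V A r" and T: "outbranching V A r T"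
  obtains L1 L2 where "trans L1" "irrefl L1" "trans L2" "irrefl L2" "T \<subseteq> L1" "T \<subseteq> L2"
    "\<And>u v. u \<in> V \<Longrightarrow> v \<in> V \<Longrightarrow> (v, u) \<notin> T\<^sup>* \<Longrightarrow> (u, v) \<in> L1 \<union> L2"
proof -
  obtain \<sigma> :: "'a \<Rightarrow> nat" where \<sigma>: "inj_on \<sigma> V"
    using finite_imp_inj_to_nat_seg[OF rooted_digraphD(1)[OF D]] by blast
  define P where "P = (\<lambda>v. SOME l. tpath T r v l)"
  have P: "tpath T r v (P v)" if "v \<in> V" for v
    unfolding P_def using tpath_exists[OF outbranchingD(3)[OF T that]] by (rule someI_ex)
  have TV: "T \<subseteq> V \<times> V" using outbranchingD(1)[OF T] rooted_digraphD(2)[OF D] by blast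
  have PV: "set (P v) \<subseteq> V" if "v \<in> V" for v
    using tpath_subset[OF P[OF that]] TV by force
  have arc: "P v = P u @ [v]" if "(u, v) \<in> T" for u v
  proof -
    have "u \<in> V" "v \<in> V" using that TV by auto
    then show ?thesis using tpath_unique[OF D T P tpath.step[OF P that]] by simp
  qed
  define L where "L = (\<lambda>R. {(u, v). (P u, P v) \<in> lexord R})"
  let ?R1 = "{(x, y). \<sigma> x < \<sigma> y}" and ?R2 = "{(x, y). \<sigma> x > \<sigma> y}"
  have "trans (L R)" if "trans R" for R
    using lexord_trans[OF _ _ that] unfolding L_def trans_def by blast
  moreover have "trans ?R1" "trans ?R2" by (auto intro!: transI)
  moreover have "irrefl (L R)" if "\<forall>x. (x, x) \<notin> R" for R
    using lexord_irreflexive[OF that] by (simp add: L_def irrefl_def)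
  moreover have "T \<subseteq> L R" for R
    using arc by (auto simp: L_def lexord_def)
  moreover have "(u, v) \<in> L ?R1 \<union> L ?R2" if "u \<in> V" "v \<in> V" "(v, u) \<notin> T\<^sup>*" for u v
  proof -
    have "\<nexists>zs. P u = P v @ zs"
      using tpath_prefix_ancestor[OF P[OF that(1)] P[OF that(2)]] that(3) by blast
    moreover have "inj_on \<sigma> (set (P u) \<union> set (P v))"
      using \<sigma> PV that by (intro inj_on_subset[OF \<sigma>]) blast
    ultimately show ?thesis using prefix_or_lexord[of \<sigma> "P u" "P v"] by (simp add: L_def)
  qed
  ultimately show ?thesis using that[of "L ?R1" "L ?R2"] by simp
qed

text \<open>Forward arcs count as well: only tree arcs and arcs to an ancestor of their tail are
  excluded.\<close>

definition cross_heads :: "'a set \<Rightarrow> ('a \<times> 'a) set \<Rightarrow> ('a \<times> 'a) set \<Rightarrow> 'a set" where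
  "cross_heads V A T = {v \<in> V. \<exists>u. (u, v) \<in> A - T \<and> (v, u) \<notin> T\<^sup>*}"

lemma not_cross_headsD:
  "v \<in> V \<Longrightarrow> v \<notin> cross_heads V A T \<Longrightarrow> (u, v) \<in> A \<Longrightarrow> (u, v) \<notin> T \<Longrightarrow> (v, u) \<in> T\<^sup>*"
  by (auto simp: cross_heads_def)

text \<open>The arc that makes \<open>v\<close> a cross head agrees with one of the two preorders,
  and the tree arc into \<open>v\<close> agrees with both. So \<open>v\<close> has in-degree at
  least two in one of two acyclic subdigraphs.\<close>

lemma cross_heads_bound:
  assumes D: "rooted_digraph V A r" and T: "outbranching V A r T"
  shows "card (cross_heads V A T) \<le> 6 * maxleaf V A r"
proof -
  note fin = rooted_digraphD(1)[OF D] and AV = rooted_digraphD(2)[OF D]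
  obtain L1 L2 where L: "trans L1" "irrefl L1" "trans L2" "irrefl L2" "T \<subseteq> L1" "T \<subseteq> L2"
    "\<And>u v. u \<in> V \<Longrightarrow> v \<in> V \<Longrightarrow> (v, u) \<notin> T\<^sup>* \<Longrightarrow> (u, v) \<in> L1 \<union> L2"
    using two_preorders[OF D T] by blast
  define K where "K = (\<lambda>L. {v \<in> V - {r}. card (in_nbrs (A \<inter> L) v) \<ge> 2})"
  have K: "card (K L) \<le> 3 * maxleaf V A r" if L: "trans L" "irrefl L" "T \<subseteq> L" for L
    unfolding K_def
  proof (rule acyclic_subdigraph_leaves[OF D])
    have "acyclic L" using L(1,2) by (simp add: acyclic_irrefl trancl_id)
    then show "acyclic (A \<inter> L)" by (rule acyclic_subset) blast
    show "\<exists>u. (u, v) \<in> A \<inter> L" if "v \<in> V - {r}" for v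
      using outbranchingD(1,2)[OF T] that L(3) by blast
  qed blast
  have "v \<in> K L1 \<union> K L2" if v: "v \<in> cross_heads V A T" for v
  proof -
    obtain u where u: "(u, v) \<in> A" "(u, v) \<notin> T" "(v, u) \<notin> T\<^sup>*" "v \<in> V"
      using v by (auto simp: cross_heads_def)
    have vr: "v \<in> V - {r}" using u rooted_digraphD(4)[OF D] by blast
    obtain w where w: "(w, v) \<in> T" using outbranchingD(2)[OF T vr] by blast
    then have "w \<noteq> u" "(w, v) \<in> A" using u(2) outbranchingD(1)[OF T] by blast+
    have *: "card (in_nbrs (A \<inter> L) v) \<ge> 2" if "T \<subseteq> L" "(u, v) \<in> L" for L
    proof -
      have "finite (in_nbrs (A \<inter> L) v)"
        using AV by (intro finite_subset[OF _ fin]) (auto simp: in_nbrs_def)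
      moreover have "{u, w} \<subseteq> in_nbrs (A \<inter> L) v"
        using that w u(1) \<open>(w, v) \<in> A\<close> by (auto simp: in_nbrs_def)
      ultimately show ?thesis using card_mono[of _ "{u, w}"] \<open>w \<noteq> u\<close> by fastforce
    qed
    have "u \<in> V" using u(1) AV by blast
    then show ?thesis using L(7)[OF _ u(4) u(3)] *[OF L(5)] *[OF L(6)] vr by (auto simp: K_def)
  qed
  then have "card (cross_heads V A T) \<le> card (K L1 \<union> K L2)"
    using fin by (intro card_mono) (auto simp: K_def)
  also have "\<dots> \<le> card (K L1) + card (K L2)" by (rule card_Un_le)
  finally show ?thesis using K[OF L(1,2,5)] K[OF L(3,4,6)] by linarith
qed

section \<open>Non special components\<close>

lemma outbranching_acyclic:
  assumes "rooted_digraph V A r" "outbranching V A r T"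
  shows "acyclic T"
proof -
  obtain L1 L2 :: "('a \<times> 'a) set" where "trans L1" "irrefl L1" "T \<subseteq> L1"
    by (rule two_preorders[OF assms]) (rule that)
  then show ?thesis by (intro acyclic_subset[of L1 T]) (simp_all add: acyclic_irrefl trancl_id)
qed

text \<open>The bound n - 1 on the edges of a connected graph, with each edge counted as two arcs. A
  set grown from \<open>v\<close> gains two arcs with each new vertex.\<close>

lemma symmetric_connected_card:
  assumes fin: "finite C" and E: "E \<subseteq> C \<times> C" "sym E" and v: "v \<in> C" "\<forall>w\<in>C. (v, w) \<in> E\<^sup>*"
  shows "2 * card C \<le> card E + 2"
proof -
  have finE: "finite E" using E(1) fin by (rule finite_subset[OF _ finite_cartesian_product]) (rule fin)
  have "\<exists>S\<subseteq>C. v \<in> S \<and> card S = Suc k \<and> 2 * Suc k \<le> card (E \<inter> S \<times> S) + 2" if "Suc k \<le> card C" for k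
    using that
  proof (induction k)
    case 0
    show ?case by (rule exI[of _ "{v}"]) (simp add: v)
  next
    case (Suc k)
    then obtain S where S: "S \<subseteq> C" "v \<in> S" "card S = Suc k" "2 * Suc k \<le> card (E \<inter> S \<times> S) + 2"
      by auto
    have finS: "finite S" using S(1) fin by (rule finite_subset)
    have "\<exists>x y. (x, y) \<in> E \<and> x \<in> S \<and> y \<notin> S"
    proof (rule ccontr)
      assume no: "\<not> ?thesis"
      have "w \<in> S" if "(v, w) \<in> E\<^sup>*" for w
        using that by induction (use S(2) no in blast)+
      then have "C \<subseteq> S" using v(2) by blast
      then show False using S(1,3) Suc.prems by simp
    qed
    then obtain x y where xy: "(x, y) \<in> E" "x \<in> S" "y \<notin> S" by blast
    have "(y, x) \<in> E" using xy(1) E(2) by (rule symD[rotated])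
    then have sub: "{(x, y), (y, x)} \<union> (E \<inter> S \<times> S) \<subseteq> E \<inter> insert y S \<times> insert y S"
      using xy by blast
    have "card ({(x, y), (y, x)} \<union> (E \<inter> S \<times> S)) = 2 + card (E \<inter> S \<times> S)"
    proof -
      have "x \<noteq> y" using xy by blast
      then have "card {(x, y), (y, x)} = 2" by simp
      moreover have "{(x, y), (y, x)} \<inter> (E \<inter> S \<times> S) = {}" using xy(3) by blast
      ultimately show ?thesis using finE by (subst card_Un_disjoint) simp_all
    qed
    moreover have "card ({(x, y), (y, x)} \<union> (E \<inter> S \<times> S)) \<le> card (E \<inter> insert y S \<times> insert y S)"
      using finE by (intro card_mono[OF _ sub]) simp
    ultimately have "2 * Suc (Suc k) \<le> card (E \<inter> insert y S \<times> insert y S) + 2" using S(4) by simp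
    moreover have "insert y S \<subseteq> C" using xy(1) E(1) S(1) by blast
    moreover have "card (insert y S) = Suc (Suc k)" using finS xy(3) S(3) by simp
    ultimately show ?case using S(2) by (intro exI[of _ "insert y S"]) simp
  qed
  note ex = this
  have "card C \<noteq> 0" using fin v(1) by auto
  then obtain k where k: "card C = Suc k" using not0_implies_Suc by blast
  then obtain S where "2 * card C \<le> card (E \<inter> S \<times> S) + 2" using ex[of k] by auto
  moreover have "card (E \<inter> S \<times> S) \<le> card E" using finE by (intro card_mono) auto
  ultimately show ?thesis by linarith
qed

text \<open>A vertex without simple in-arc is no child of \<open>r\<close>, since nothing enters
  \<open>r\<close>. Its two parents in the numbering are then distinct, which excludes in-degree
  below two.\<close>

lemma special_iff_not_non_special:
  assumes D: "rooted_digraph V A r" and con: "two_connected V A r" and v: "v \<in> V - {r}"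
  shows "special V A v \<longleftrightarrow> \<not> non_special V A v"
proof
  assume "special V A v"
  then show "\<not> non_special V A v"
    by (auto simp: special_def non_special_def simple_arc_def in_nbrs_def out_nbrs_def)
next
  assume "\<not> non_special V A v"
  show "special V A v"
  proof (rule ccontr)
    assume ns: "\<not> special V A v"
    have sub: "in_nbrs A v \<subseteq> out_nbrs A v"
      using ns v by (auto simp: special_def simple_arc_def in_nbrs_def out_nbrs_def)
    then have "(r, v) \<notin> A"
      using rooted_digraphD(4)[OF D] by (auto simp: in_nbrs_def out_nbrs_def)
    moreover obtain \<sigma> f b where "rr_numbering V A r \<sigma> f b"
      using rr_numbering_exists[OF D con] by blast
    ultimately have "(f v, v) \<in> A" "(b v, v) \<in> A" "f v \<noteq> b v"
      using v unfolding rr_numbering_def by (force split: if_splits)+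
    then have "\<exists>u w. u \<noteq> w \<and> {u, w} \<subseteq> in_nbrs A v"
      by (intro exI[of _ "f v"] exI[of _ "b v"]) (simp add: in_nbrs_def)
    then obtain u w where uw: "u \<noteq> w" "{u, w} \<subseteq> in_nbrs A v" by blast
    have "finite (in_nbrs A v)"
      using rooted_digraphD(1,2)[OF D] finite_subset[of "in_nbrs A v" V] by (auto simp: in_nbrs_def)
    then have "card {u, w} \<le> card (in_nbrs A v)" using uw(2) by (rule card_mono)
    then have "card (in_nbrs A v) = 2" using uw(1) ns v by (auto simp: special_def)
    then show False using \<open>\<not> non_special V A v\<close> sub v by (simp add: non_special_def)
  qed
qed

lemma not_root_of_special:
  assumes D: "rooted_digraph V A r"
  shows "special V A v \<Longrightarrow> v \<in> V - {r}" "non_special V A v \<Longrightarrow> v \<in> V - {r}"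
proof -
  have "in_nbrs A r = {}" using rooted_digraphD(4)[OF D] by (auto simp: in_nbrs_def)
  then show "special V A v \<Longrightarrow> v \<in> V - {r}" "non_special V A v \<Longrightarrow> v \<in> V - {r}"
    using rooted_digraphD(4)[OF D] by (auto simp: special_def non_special_def simple_arc_def)
qed

lemma non_special_arc_back: "non_special V A v \<Longrightarrow> (u, v) \<in> A \<Longrightarrow> (v, u) \<in> A"
  by (auto simp: non_special_def in_nbrs_def out_nbrs_def)

section \<open>Components as classes of a symmetric relation\<close>

definition ns_arcs :: "'a set \<Rightarrow> ('a \<times> 'a) set \<Rightarrow> ('a \<times> 'a) set" where
  "ns_arcs V A = A \<inter> (non_special_vertices V A \<times> non_special_vertices V A)"

lemma sym_ns_arcs: "sym (ns_arcs V A)"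
  by (auto intro!: symI simp: ns_arcs_def non_special_vertices_def dest: non_special_arc_back)

text \<open>Arcs between non special vertices come in opposite pairs, so the symmetric closure in
  the definition adds nothing.\<close>

lemma non_special_components_alt:
  "non_special_components V A =
    (\<lambda>v. {w \<in> non_special_vertices V A. (v, w) \<in> (ns_arcs V A)\<^sup>*}) ` non_special_vertices V A"
proof -
  have "ns_arcs V A \<union> (ns_arcs V A)\<inverse> = ns_arcs V A" using sym_ns_arcs[of V A] sym_conv_converse_eq[of "ns_arcs V A"] by simp
  note this[unfolded ns_arcs_def]
  then show ?thesis unfolding non_special_components_def Let_def ns_arcs_def by auto
qed

lemma component_closed:
  assumes C: "C \<in> non_special_components V A" and "x \<in> C" "(x, y) \<in> (ns_arcs V A)\<^sup>*"
  shows "y \<in> C"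
proof -
  have "y \<in> non_special_vertices V A"
    using assms(3)
  proof cases
    case base
    then show ?thesis using C \<open>x \<in> C\<close> by (auto simp: non_special_components_alt)
  qed (simp add: ns_arcs_def)
  then show ?thesis using assms by (auto simp: non_special_components_alt)
qed

lemma component_connected:
  assumes C: "C \<in> non_special_components V A" and "x \<in> C" "y \<in> C"
  shows "(x, y) \<in> (ns_arcs V A)\<^sup>*"
proof -
  obtain v where v: "(v, x) \<in> (ns_arcs V A)\<^sup>*" "(v, y) \<in> (ns_arcs V A)\<^sup>*"
    using assms by (auto simp: non_special_components_alt)
  show ?thesis by (rule rtrancl_trans[OF symD[OF sym_rtrancl[OF sym_ns_arcs] v(1)] v(2)])
qed

lemma components_disjoint:
  assumes "C \<in> non_special_components V A" "C' \<in> non_special_components V A" "x \<in> C" "x \<in> C'"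
  shows "C = C'"
proof -
  have sub: "B \<subseteq> B'" if "B \<in> non_special_components V A" "B' \<in> non_special_components V A" "x \<in> B" "x \<in> B'"
    for B B'
    using component_closed[OF that(2,4) component_connected[OF that(1,3)]] by blast
  show ?thesis by (rule equalityI; rule sub) (rule assms)+
qed

lemma component_subset:
  "C \<in> non_special_components V A \<Longrightarrow> x \<in> C \<Longrightarrow> non_special V A x"
  by (auto simp: non_special_components_alt non_special_vertices_def)

lemma component_cover: "non_special V A x \<Longrightarrow> \<exists>C\<in>non_special_components V A. x \<in> C"
  by (auto simp: non_special_components_alt non_special_vertices_def)

lemma component_nonempty: "C \<in> non_special_components V A \<Longrightarrow> C \<noteq> {}"
  by (auto simp: non_special_components_alt)

lemma component_arc:
  assumes "C \<in> non_special_components V A" "x \<in> C" "(x, y) \<in> A" "non_special V A y"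
  shows "y \<in> C"
proof -
  have "(x, y) \<in> ns_arcs V A"
    using assms component_subset[OF assms(1,2)] by (simp add: ns_arcs_def non_special_vertices_def)
  then show ?thesis by (rule component_closed[OF assms(1,2) r_into_rtrancl])
qed

lemma finite_non_special_components: "finite V \<Longrightarrow> finite (non_special_components V A)"
  unfolding non_special_components_alt
  by (rule finite_imageI, rule finite_subset[of _ V])
    (auto simp: non_special_vertices_def non_special_def)

lemma component_arcs_card:
  assumes D: "rooted_digraph V A r" and C: "C \<in> non_special_components V A"
  shows "2 * card C \<le> card (A \<inter> C \<times> C) + 2"
proof -
  obtain v where v: "v \<in> C" using component_nonempty[OF C] by blast
  have CV: "C \<subseteq> V" using component_subset[OF C] by (auto simp: non_special_def)
  have "(v, w) \<in> (A \<inter> C \<times> C)\<^sup>*" if "(v, w) \<in> (ns_arcs V A)\<^sup>*" for w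
    using that
  proof induction
    case base then show ?case by simp
  next
    case (step x y)
    have "x \<in> C" "y \<in> C"
      using component_closed[OF C v] step(1) rtrancl_into_rtrancl[OF step(1,2)] by blast+
    then have "(x, y) \<in> A \<inter> C \<times> C" using step(2) by (simp add: ns_arcs_def)
    then show ?case using step(3) by (rule rtrancl_into_rtrancl[rotated])
  qed
  moreover have "sym (A \<inter> C \<times> C)"
    using non_special_arc_back component_subset[OF C] by (fastforce intro: symI)
  ultimately show ?thesis
    using component_connected[OF C v] v finite_subset[OF CV rooted_digraphD(1)[OF D]]
    by (intro symmetric_connected_card[of C _ v]) auto
qed

text \<open>Of the \<open>2|C|\<close> arcs into \<open>C\<close>, connectedness puts at least
  \<open>2|C| - 2\<close> inside, so at most two tree arcs enter from outside and at least
  \<open>|C| - 2\<close> lie inside. These start at distinct vertices, none of them a leaf.\<close>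

lemma component_leaves_le_2:
  assumes D: "rooted_digraph V A r" and T: "outbranching V A r T" and C: "C \<in> non_special_components V A"
  shows "card (leaves V T \<inter> C) \<le> 2"
proof -
  note fin = rooted_digraphD(1)[OF D] and AV = rooted_digraphD(2)[OF D]
  have finA: "finite A" using AV fin by (meson finite_SigmaI finite_subset)
  have CV: "C \<subseteq> V" using component_subset[OF C] by (auto simp: non_special_def)
  have finC: "finite C" using CV fin by (rule finite_subset)
  have finT: "finite T" using outbranchingD(1)[OF T] finA by (rule finite_subset)
  have "card (A \<inter> UNIV \<times> C) = (\<Sum>v\<in>C. card (in_nbrs A v))"
  proof -
    have "A \<inter> UNIV \<times> C = (\<Union>v\<in>C. (\<lambda>u. (u, v)) ` in_nbrs A v)" by (auto simp: in_nbrs_def)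
    moreover have "finite (in_nbrs A v)" for v
      using AV by (intro finite_subset[OF _ fin]) (auto simp: in_nbrs_def)
    ultimately show ?thesis
      using finC by (simp add: card_UN_disjoint card_image inj_on_def disjoint_iff image_iff)
  qed
  also have "\<dots> = 2 * card C" using component_subset[OF C] by (simp add: non_special_def)
  finally have "card (A \<inter> UNIV \<times> C) = 2 * card C" .
  moreover have split: "card (X \<inter> UNIV \<times> C) = card (X \<inter> C \<times> C) + card (X \<inter> (- C) \<times> C)"
    if "finite X" for X :: "('a \<times> 'a) set"
    using that by (subst card_Un_disjoint[symmetric]) (auto intro: arg_cong[where f = card])
  ultimately have "card (A \<inter> (- C) \<times> C) \<le> 2"
    using component_arcs_card[OF D C] split[OF finA] by linarith
  moreover have "card (T \<inter> (- C) \<times> C) \<le> card (A \<inter> (- C) \<times> C)"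
    using outbranchingD(1)[OF T] finA by (intro card_mono) auto
  moreover have "card C \<le> card (T \<inter> UNIV \<times> C)"
  proof (rule surj_card_le[of _ _ snd])
    show "C \<subseteq> snd ` (T \<inter> UNIV \<times> C)"
    proof
      fix v assume v: "v \<in> C"
      then have "v \<in> V - {r}" using component_subset[OF C] not_root_of_special(2)[OF D] by blast
      then obtain u where "(u, v) \<in> T" using outbranchingD(2)[OF T] by blast
      then show "v \<in> snd ` (T \<inter> UNIV \<times> C)" using v by force
    qed
  qed (use finT in simp)
  ultimately have "card C \<le> card (T \<inter> C \<times> C) + 2" using split[OF finT] by linarith
  moreover have "card (T \<inter> C \<times> C) \<le> card (C - leaves V T)"
  proof (rule card_inj_on_le[of fst])
    show "fst ` (T \<inter> C \<times> C) \<subseteq> C - leaves V T" by (auto simp: leaves_def out_nbrs_def)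
    \<comment> \<open>Two children in \<open>C\<close> would be the only in-neighbours of
      \<open>u\<close>, so the parent of \<open>u\<close> would also be its child.\<close>
    have "c = d" if "(u, c) \<in> T" "(u, d) \<in> T" "u \<in> C" "c \<in> C" "d \<in> C" for u c d
    proof (rule ccontr)
      assume "c \<noteq> d"
      have TA: "T \<subseteq> A" by (rule outbranchingD(1)[OF T])
      have u: "non_special V A u" by (rule component_subset[OF C \<open>u \<in> C\<close>])
      have cu: "(c, u) \<in> A" "(d, u) \<in> A"
        using non_special_arc_back[OF component_subset[OF C \<open>c \<in> C\<close>], of u]
          non_special_arc_back[OF component_subset[OF C \<open>d \<in> C\<close>], of u] that(1,2) TA by blast+
      have "{c, d} \<subseteq> in_nbrs A u" using cu by (simp add: in_nbrs_def)
      moreover have "card (in_nbrs A u) = 2" using u by (simp add: non_special_def)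
      moreover from this have "finite (in_nbrs A u)" by (intro card_ge_0_finite) simp
      ultimately have in2: "in_nbrs A u = {c, d}"
        using card_seteq[of "in_nbrs A u" "{c, d}"] \<open>c \<noteq> d\<close> by simp
      obtain w where w: "(w, u) \<in> T"
        using outbranchingD(2)[OF T] not_root_of_special(2)[OF D u] by blast
      then have "w = c \<or> w = d" using TA in2 by (auto simp: in_nbrs_def)
      then have "(u, w) \<in> T" using that by blast
      then have "(u, u) \<in> T\<^sup>+" using w by (meson trancl.simps)
      then show False using outbranching_acyclic[OF D T] by (simp add: acyclic_def)
    qed
    then show "inj_on fst (T \<inter> C \<times> C)" by (auto simp: inj_on_def)
    show "finite (C - leaves V T)" using finC by simp
  qed
  moreover have "card C = card (leaves V T \<inter> C) + card (C - leaves V T)"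
    using finC card_Int_Diff[of C "leaves V T"] by (simp add: Int_commute)
  ultimately show ?thesis by linarith
qed

section \<open>Counting leaves against components\<close>

lemma leaves_upper_bound:
  assumes D: "rooted_digraph V A r" and con: "two_connected V A r" and T: "outbranching V A r T"
  shows "card (leaves V T) \<le> card (special_vertices V A) + 2 * card (non_special_components V A)"
proof -
  note fin = rooted_digraphD(1)[OF D]
  let ?H = "non_special_components V A"
  have "r \<notin> leaves V T"
  proof -
    have "card (out_nbrs A r) \<noteq> 0" using D by (auto simp: rooted_digraph_def)
    then obtain v where v: "(r, v) \<in> A" by (auto simp: out_nbrs_def card_eq_0_iff)
    then have "v \<in> V - {r}" using rooted_digraphD(2,4)[OF D] by blast
    then obtain u where u: "(u, v) \<in> T" using outbranchingD(2)[OF T] by blast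
    then have "u = r" using rooted_digraphD(6)[OF D v] outbranchingD(1)[OF T] by blast
    then show ?thesis using u by (auto simp: leaves_def out_nbrs_def)
  qed
  have "leaves V T \<subseteq> special_vertices V A \<union> (\<Union>C\<in>?H. leaves V T \<inter> C)"
  proof
    fix v assume v: "v \<in> leaves V T"
    then have "v \<in> V - {r}" using \<open>r \<notin> leaves V T\<close> by (auto simp: leaves_def)
    then have "special V A v \<or> non_special V A v"
      using special_iff_not_non_special[OF D con] by blast
    then show "v \<in> special_vertices V A \<union> (\<Union>C\<in>?H. leaves V T \<inter> C)"
      using component_cover[of V A v] v by (auto simp: special_vertices_def)
  qed
  then have "card (leaves V T) \<le> card (special_vertices V A \<union> (\<Union>C\<in>?H. leaves V T \<inter> C))"
    using fin finite_non_special_components[OF fin]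
    by (intro card_mono) (auto simp: special_vertices_def special_def leaves_def)
  also have "\<dots> \<le> card (special_vertices V A) + card (\<Union>C\<in>?H. leaves V T \<inter> C)"
    by (rule card_Un_le)
  also have "card (\<Union>C\<in>?H. leaves V T \<inter> C) \<le> (\<Sum>C\<in>?H. card (leaves V T \<inter> C))"
    by (rule card_UN_le[OF finite_non_special_components[OF fin]])
  also have "\<dots> \<le> (\<Sum>C\<in>?H. 2)" by (intro sum_mono component_leaves_le_2[OF D T])
  finally show ?thesis by simp
qed

text \<open>A lowest vertex \<open>x\<close> of a component has no child inside it. Either
  \<open>x\<close> is a leaf, or it has a special child, because arcs to non special vertices stay
  in the component. That child determines its parent \<open>x\<close> and hence the
  component.\<close>

lemma components_le_special_plus_leaves:
  assumes D: "rooted_digraph V A r" and con: "two_connected V A r" and T: "outbranching V A r T"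
  shows "card (non_special_components V A) \<le> card (special_vertices V A) + card (leaves V T)"
proof -
  note fin = rooted_digraphD(1)[OF D] and AV = rooted_digraphD(2)[OF D]
  let ?H = "non_special_components V A"
  have "finite A" using AV fin by (meson finite_SigmaI finite_subset)
  then have "finite T" using outbranchingD(1)[OF T] finite_subset by blast
  then have wf: "wf (T\<inverse>)" using outbranching_acyclic[OF D T] by (rule finite_acyclic_wf_converse)
  have ex: "\<exists>x y. x \<in> C \<and> (y = x \<and> x \<in> leaves V T \<or> special V A y \<and> (x, y) \<in> T)"
    if C: "C \<in> ?H" for C
  proof -
    obtain x where x: "x \<in> C" "\<forall>y. (x, y) \<in> T \<longrightarrow> y \<notin> C"
      by (rule wfE_min'[OF wf component_nonempty[OF C]]) simp
    have "x \<in> V" using component_subset[OF C x(1)] by (simp add: non_special_def)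
    show ?thesis
    proof (cases "x \<in> leaves V T")
      case False
      then obtain y where y: "(x, y) \<in> T" using \<open>x \<in> V\<close> by (auto simp: leaves_def out_nbrs_def)
      then have "(x, y) \<in> A" using outbranchingD(1)[OF T] by blast
      then have "\<not> non_special V A y" using x(2) y component_arc[OF C x(1), of y] by blast
      moreover have "y \<in> V - {r}" using \<open>(x, y) \<in> A\<close> rooted_digraphD(2,4)[OF D] by blast
      ultimately show ?thesis using special_iff_not_non_special[OF D con] x(1) y by blast
    qed (use x in blast)
  qed
  obtain x y where xy: "\<And>C. C \<in> ?H \<Longrightarrow>
      x C \<in> C \<and> (y C = x C \<and> x C \<in> leaves V T \<or> special V A (y C) \<and> (x C, y C) \<in> T)"
    using ex by metis
  have "inj_on y ?H"
  proof (rule inj_onI)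
    fix C C' assume C: "C \<in> ?H" "C' \<in> ?H" "y C = y C'"
    \<comment> \<open>This excludes that a leaf chosen for one component is the special child chosen
      for another.\<close>
    have ns: "\<not> special V A (x B)" if "B \<in> ?H" for B
    proof -
      have "non_special V A (x B)" using component_subset[OF that] xy[OF that] by blast
      then show ?thesis
        using special_iff_not_non_special[OF D con] not_root_of_special(2)[OF D] by blast
    qed
    have "x C = x C'"
      using xy[OF C(1)] xy[OF C(2)] ns[OF C(1)] ns[OF C(2)] C(3)
        outbranching_parent_unique[OF D T, of "x C" "y C" "x C'"] by metis
    then show "C = C'" using components_disjoint[OF C(1,2)] xy[OF C(1)] xy[OF C(2)] by metis
  qed
  moreover have "y C \<in> special_vertices V A \<union> leaves V T" if "C \<in> ?H" for C
    using xy[OF that] by (auto simp: special_vertices_def)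
  moreover have "finite (special_vertices V A \<union> leaves V T)"
    using fin by (auto simp: special_vertices_def special_def leaves_def)
  ultimately have "card ?H \<le> card (special_vertices V A \<union> leaves V T)"
    by (intro card_inj_on_le[of y]) auto
  also have "\<dots> \<le> card (special_vertices V A) + card (leaves V T)" by (rule card_Un_le)
  finally show ?thesis .
qed

section \<open>Special vertices\<close>

text \<open>Reversing the order lets each result on the forward tree be reused for the backward
  one.\<close>

lemma rr_numbering_swap: "rr_numbering V A r \<sigma> f b \<Longrightarrow> rr_numbering V A r (\<lambda>v. - \<sigma> v) b f"
  unfolding rr_numbering_def inj_on_def by (auto split: if_splits)

lemma rr_numberingD:
  assumes "rr_numbering V A r \<sigma> f b" "v \<in> V - {r}"
  shows "(f v, v) \<in> A" "(b v, v) \<in> A" "(r, v) \<in> A \<Longrightarrow> f v = r"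
    "(r, v) \<notin> A \<Longrightarrow> f v \<in> V - {r}" "(r, v) \<notin> A \<Longrightarrow> b v \<in> V - {r}"
    "(r, v) \<notin> A \<Longrightarrow> \<sigma> (f v) < \<sigma> v" "(r, v) \<notin> A \<Longrightarrow> \<sigma> v < \<sigma> (b v)"
  using assms by (auto simp: rr_numbering_def split: if_splits)

abbreviation parent_arcs :: "'a set \<Rightarrow> 'a \<Rightarrow> ('a \<Rightarrow> 'a) \<Rightarrow> ('a \<times> 'a) set" where
  "parent_arcs V r p \<equiv> (\<lambda>v. (p v, v)) ` (V - {r})"

text \<open>The value of \<open>\<sigma>\<close> at \<open>r\<close> is arbitrary, hence the
  exception for paths that start there.\<close>

lemma parent_arcs_increasing:
  assumes N: "rr_numbering V A r \<sigma> f b" and uv: "(u, v) \<in> (parent_arcs V r f)\<^sup>+"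
  shows "v \<noteq> r \<and> (u = r \<or> \<sigma> u < \<sigma> v)"
proof -
  have arc: "y \<noteq> r \<and> (x = r \<or> \<sigma> x < \<sigma> y)" if "(x, y) \<in> parent_arcs V r f" for x y
  proof -
    have y: "y \<in> V - {r}" "x = f y" using that by auto
    then show ?thesis using rr_numberingD(3,6)[OF N y(1)] by auto
  qed
  show ?thesis
    using uv
  proof (induction rule: trancl_induct)
    case (base y) then show ?case by (rule arc)
  next
    case (step y z)
    then show ?case using arc[OF step(2)] by auto
  qed
qed

lemma parent_arcs_outbranching:
  assumes D: "rooted_digraph V A r" and N: "rr_numbering V A r \<sigma> f b"
  shows "outbranching V A r (parent_arcs V r f)"
proof (rule outbranching_of_parents[OF D])
  show "(f v, v) \<in> A" if "v \<in> V - {r}" for v by (rule rr_numberingD(1)[OF N that])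
  show "acyclic (parent_arcs V r f)"
    unfolding acyclic_def using parent_arcs_increasing[OF N] by blast
qed

text \<open>If no relevant arc is a cross arc, the tree paths from v to f v backwards and from f v to
  b (f v) forwards squeeze b (f v) onto v, so that the arc (f v, v) is not simple.\<close>
lemma simple_in_arc_bound:
  assumes D: "rooted_digraph V A r" and N: "rr_numbering V A r \<sigma> f b"
  shows "card {v \<in> V - {r}. (r, v) \<notin> A \<and> v \<notin> cross_heads V A (parent_arcs V r b) \<and> (v, f v) \<notin> A}
    \<le> 7 * maxleaf V A r" (is "card ?S \<le> _")
proof -
  note fin = rooted_digraphD(1)[OF D] and AV = rooted_digraphD(2)[OF D]
  let ?F = "parent_arcs V r f" and ?B = "parent_arcs V r b"
  note N' = rr_numbering_swap[OF N]
  note TF = parent_arcs_outbranching[OF D N] and TB = parent_arcs_outbranching[OF D N']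
  let ?X = "cross_heads V A ?F"
  let ?NF = "{v. \<exists>u c. (u, v) \<in> ?F \<and> (u, c) \<in> ?F \<and> \<sigma> c < \<sigma> v}"
  have key: "f v \<in> ?X \<or> v \<in> ?NF" if v: "v \<in> ?S" for v
  proof (rule disjCI)
    assume notNF: "v \<notin> ?NF"
    have vW: "v \<in> V - {r}" "(r, v) \<notin> A" "(v, f v) \<notin> A" using v by auto
    define u where "u = f v"
    have uW: "u \<in> V - {r}" unfolding u_def by (rule rr_numberingD(4)[OF N vW(1,2)])
    have uv: "(u, v) \<in> A" unfolding u_def by (rule rr_numberingD(1)[OF N vW(1)])
    have lt: "\<sigma> u < \<sigma> v" "\<sigma> v < \<sigma> (b v)"
      unfolding u_def using rr_numberingD(6,7)[OF N vW(1,2)] by auto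
    then have "u \<noteq> b v" by auto
    then have "(u, v) \<notin> ?B" by auto
    moreover have "v \<notin> cross_heads V A ?B" "v \<in> V" using v by blast+
    ultimately have "(v, u) \<in> ?B\<^sup>*" using uv by (intro not_cross_headsD[of v V A])
    \<comment> \<open>The arc \<open>(u, v)\<close> must lead to an ancestor of its tail in the
      backward tree. On the tree path from \<open>v\<close> down to \<open>u\<close>, the last
      vertex before \<open>u\<close> is \<open>w = b u\<close>, numbered no higher than
      \<open>v\<close>.\<close>
    then have "(v, u) \<in> ?B\<^sup>+" using lt(1) by (auto dest: rtranclD)
    from tranclD2[OF this] obtain w where w: "(v, w) \<in> ?B\<^sup>*" "(w, u) \<in> ?B" by blast
    have wb: "w = b u" using w(2) by auto
    have vw: "w = v \<or> w \<noteq> r \<and> \<sigma> w < \<sigma> v"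
      using rtranclD[OF w(1)] parent_arcs_increasing[OF N', of v w] vW(1) by auto
    have wuA: "(w, u) \<in> A" unfolding wb by (rule rr_numberingD(2)[OF N uW])
    \<comment> \<open>Simplicity enters here: \<open>(w, u)\<close> is an arc and
      \<open>(v, u)\<close> is not, so \<open>w\<close> is numbered strictly below
      \<open>v\<close>.\<close>
    then have "w \<noteq> v" using vW(3) by (auto simp: u_def)
    then have w': "w \<noteq> r" "\<sigma> w < \<sigma> v" using vw by auto
    have ru: "(r, u) \<notin> A" using rooted_digraphD(6)[OF D _ wuA] w'(1) by blast
    have lt': "\<sigma> (f u) < \<sigma> u" "\<sigma> u < \<sigma> w"
      using rr_numberingD(6,7)[OF N uW ru] by (auto simp: wb)
    then have wF: "(w, u) \<notin> ?F" by auto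
    show "f v \<in> ?X"
    proof (rule ccontr)
      assume "f v \<notin> ?X"
      then have "(u, w) \<in> ?F\<^sup>*"
        using uW wuA wF by (intro not_cross_headsD[of u V A]) (simp_all add: u_def)
      then have "(u, w) \<in> ?F\<^sup>+" using lt'(2) by (auto dest: rtranclD)
      \<comment> \<open>The first step of the forward path from \<open>u\<close> to \<open>w\<close>
        is a child of \<open>u\<close> numbered below \<open>v\<close>, so \<open>v\<close> is not
        the first child.\<close>
      from tranclD[OF this] obtain c where c: "(u, c) \<in> ?F" "(c, w) \<in> ?F\<^sup>*" by blast
      have "c \<noteq> r" using c(1) by auto
      then have "\<sigma> c \<le> \<sigma> w" using rtranclD[OF c(2)] parent_arcs_increasing[OF N, of c w] by auto
      then have "\<sigma> c < \<sigma> v" using w'(2) by simp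
      moreover have "(u, v) \<in> ?F" using vW(1) by (auto simp: u_def)
      ultimately show False using notNF c(1) by blast
    qed
  qed
  \<comment> \<open>First children of distinct number have distinct parents, so each cross head is
    charged once. The 7 is 6 for these heads and 1 for the children that are not first.\<close>
  have "inj_on f (?S - ?NF)"
  proof (rule inj_onI)
    fix v v' assume v: "v \<in> ?S - ?NF" "v' \<in> ?S - ?NF" "f v = f v'"
    have W: "v \<in> V - {r}" "v' \<in> V - {r}" using v(1,2) by blast+
    have "(f v, v) \<in> ?F" using W(1) by blast
    moreover have "(f v, v') \<in> ?F" unfolding v(3) using W(2) by blast
    ultimately have "\<not> \<sigma> v < \<sigma> v'" "\<not> \<sigma> v' < \<sigma> v" using v(1,2) by blast+
    then have "\<sigma> v = \<sigma> v'" by simp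
    moreover have "inj_on \<sigma> (V - {r})" using N by (simp add: rr_numbering_def)
    ultimately show "v = v'" using W by (blast dest: inj_onD)
  qed
  moreover have "f ` (?S - ?NF) \<subseteq> ?X" using key by blast
  moreover have "finite ?X" by (rule finite_subset[OF _ fin]) (auto simp: cross_heads_def)
  ultimately have "card (?S - ?NF) \<le> card ?X" by (rule card_inj_on_le)
  moreover have "card ?X \<le> 6 * maxleaf V A r" by (rule cross_heads_bound[OF D TF])
  moreover have "card ?NF \<le> maxleaf V A r"
    using nonfirst_children_bound[OF D TF, of \<sigma>] leaves_le_maxleaf[OF D TF] by linarith
  moreover have "card ?S \<le> card ((?S - ?NF) \<union> ?NF)"
  proof (rule card_mono)
    have "?NF \<subseteq> V" by auto
    then have "finite ?NF" using fin by (rule finite_subset)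
    then show "finite ((?S - ?NF) \<union> ?NF)" using fin by simp
  qed blast
  moreover have "card ((?S - ?NF) \<union> ?NF) \<le> card (?S - ?NF) + card ?NF" by (rule card_Un_le)
  ultimately show ?thesis by linarith
qed

text \<open>All children of \<open>r\<close> except the first are non-first children; the
  \<open>+ 1\<close> of \<open>nonfirst_children_bound\<close> absorbs the exception.\<close>

lemma root_children_bound:
  assumes D: "rooted_digraph V A r" and N: "rr_numbering V A r \<sigma> f b"
  shows "card {v. (r, v) \<in> A} \<le> maxleaf V A r"
proof -
  let ?F = "parent_arcs V r f"
  note TF = parent_arcs_outbranching[OF D N]
  let ?NF = "{v. \<exists>u c. (u, v) \<in> ?F \<and> (u, c) \<in> ?F \<and> \<sigma> c < \<sigma> v}"
  let ?C = "{v. (r, v) \<in> A}"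
  have CW: "?C \<subseteq> V - {r}" using rooted_digraphD(2,4)[OF D] by blast
  have arc: "(r, v) \<in> ?F" if "v \<in> ?C" for v
  proof -
    have "v \<in> V - {r}" "f v = r" using that CW rr_numberingD(3)[OF N, of v] by auto
    then show ?thesis by force
  qed
  have eq: "v = w" if "v \<in> ?C - ?NF" "w \<in> ?C - ?NF" for v w
  proof -
    have "\<not> \<sigma> v < \<sigma> w" "\<not> \<sigma> w < \<sigma> v" using that arc[of v] arc[of w] by blast+
    then have "\<sigma> v = \<sigma> w" by simp
    moreover have "inj_on \<sigma> (V - {r})" using N by (simp add: rr_numbering_def)
    ultimately show ?thesis using that CW by (meson Diff_iff inj_onD subsetD)
  qed
  have fin: "finite ?C" "finite ?NF"
    using rooted_digraphD(1)[OF D] CW by (auto intro: finite_subset[of _ V])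
  have "card (?C - ?NF) \<le> Suc 0"
    unfolding card_le_Suc0_iff_eq[OF finite_Diff[OF fin(1)]] by (intro ballI eq)
  moreover have "card ?C \<le> card ((?C - ?NF) \<union> ?NF)" using fin by (intro card_mono) auto
  moreover have "card ((?C - ?NF) \<union> ?NF) \<le> card (?C - ?NF) + card ?NF" by (rule card_Un_le)
  ultimately show ?thesis
    using nonfirst_children_bound[OF D TF, of \<sigma>] leaves_le_maxleaf[OF D TF] by linarith
qed

text \<open>Apart from children of \<open>r\<close> and cross heads, a vertex has no in-neighbours
  but its two parents. Its in-degree is then at most two, so it can be special only through a simple
  arc from a parent.\<close>

lemma special_vertices_bound:
  assumes D: "rooted_digraph V A r" and con: "two_connected V A r"
  shows "card (special_vertices V A) \<le> 27 * maxleaf V A r"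
proof -
  obtain \<sigma> f b where N: "rr_numbering V A r \<sigma> f b"
    using rr_numbering_exists[OF D con] by blast
  note N' = rr_numbering_swap[OF N]
  let ?W = "V - {r}"
  let ?F = "parent_arcs V r f" and ?B = "parent_arcs V r b" and ?C = "{v. (r, v) \<in> A}"
  let ?X = "cross_heads V A ?F" and ?Y = "cross_heads V A ?B"
  let ?S = "{v \<in> ?W. (r, v) \<notin> A \<and> v \<notin> ?Y \<and> (v, f v) \<notin> A}"
  let ?S' = "{v \<in> ?W. (r, v) \<notin> A \<and> v \<notin> ?X \<and> (v, b v) \<notin> A}"
  have "v \<in> ?C \<union> ?X \<union> ?Y \<union> ?S \<union> ?S'" if v: "v \<in> special_vertices V A" for v
  proof (rule ccontr)
    assume no: "v \<notin> ?C \<union> ?X \<union> ?Y \<union> ?S \<union> ?S'"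
    have sp: "special V A v" using v by (simp add: special_vertices_def)
    have vW: "v \<in> ?W" by (rule not_root_of_special(1)[OF D sp])
    have nb: "u = f v \<or> u = b v" if u: "(u, v) \<in> A" for u
    proof (rule ccontr)
      assume "\<not> (u = f v \<or> u = b v)"
      then have "(u, v) \<notin> ?F" "(u, v) \<notin> ?B" by auto
      \<comment> \<open>As \<open>v\<close> is no cross head, it is an ancestor of \<open>u\<close>
        in both trees, which forces both \<open>\<sigma> v < \<sigma> u\<close> and
        \<open>\<sigma> u < \<sigma> v\<close>.\<close>
      then have "(v, u) \<in> ?F\<^sup>*" "(v, u) \<in> ?B\<^sup>*"
        using no u vW not_cross_headsD[of v V A _ u] by blast+
      moreover have "u \<noteq> v" using u rooted_digraphD(5)[OF D] by blast
      ultimately have "(v, u) \<in> ?F\<^sup>+" "(v, u) \<in> ?B\<^sup>+" by (auto dest: rtranclD)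
      then show False
        using parent_arcs_increasing[OF N, of v u] parent_arcs_increasing[OF N', of v u] vW by auto
    qed
    then have "in_nbrs A v \<subseteq> {f v, b v}" by (auto simp: in_nbrs_def)
    then have "card (in_nbrs A v) \<le> card {f v, b v}" by (intro card_mono) simp_all
    also have "\<dots> \<le> 2" by (simp add: card_insert_if)
    finally obtain u where "(u, v) \<in> A" "(v, u) \<notin> A"
      using sp by (auto simp: special_def simple_arc_def)
    then show False using nb[of u] no vW by auto
  qed
  then have "special_vertices V A \<subseteq> ?C \<union> ?X \<union> ?Y \<union> ?S \<union> ?S'" by blast
  moreover have "finite (?C \<union> ?X \<union> ?Y \<union> ?S \<union> ?S')"
    by (rule finite_subset[OF _ rooted_digraphD(1)[OF D]])
      (use rooted_digraphD(2)[OF D] in \<open>auto simp: cross_heads_def\<close>)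
  ultimately have "card (special_vertices V A) \<le> card (?C \<union> ?X \<union> ?Y \<union> ?S \<union> ?S')"
    by (rule card_mono[rotated])
  also have "\<dots> \<le> card ?C + card ?X + card ?Y + card ?S + card ?S'"
    by (intro order.trans[OF card_Un_le] add_right_mono order.refl)
  also have "\<dots> \<le> maxleaf V A r + 6 * maxleaf V A r + 6 * maxleaf V A r + 7 * maxleaf V A r
      + 7 * maxleaf V A r"
    by (intro add_mono root_children_bound[OF D N] cross_heads_bound[OF D] parent_arcs_outbranching[OF D N]
      parent_arcs_outbranching[OF D N'] simple_in_arc_bound[OF D N] simple_in_arc_bound[OF D N'])
  finally show ?thesis by simp
qed

theorem theorem4:
  fixes V :: "'a set" and A :: "('a \<times> 'a) set" and r :: 'a and l h :: nat
  assumes "rooted_digraph V A r"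
    and "two_connected V A r"
    and "l = card (special_vertices V A)"
    and "h = card (non_special_components V A)"
  shows "max (real l / 30) (real h - real l) \<le> real (maxleaf V A r)
         \<and> maxleaf V A r \<le> l + 2 * h"
proof -
  note D = assms(1) and con = assms(2)
  obtain \<sigma> f b where "rr_numbering V A r \<sigma> f b"
    using rr_numbering_exists[OF D con] by blast
  then have "outbranching V A r (parent_arcs V r f)" by (rule parent_arcs_outbranching[OF D])
  then obtain T where T: "outbranching V A r T" "card (leaves V T) = maxleaf V A r"
    by (rule maxleaf_attained[OF D])
  have "l \<le> 27 * maxleaf V A r" using special_vertices_bound[OF D con] assms(3) by simp
  then have "real l \<le> 27 * real (maxleaf V A r)" by linarith
  then have "real l / 30 \<le> real (maxleaf V A r)" by simp
  moreover have "h \<le> l + maxleaf V A r"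
    using components_le_special_plus_leaves[OF D con T(1)] T(2) assms(3,4) by simp
  then have "real h - real l \<le> real (maxleaf V A r)" by linarith
  moreover have "maxleaf V A r \<le> l + 2 * h"
    using leaves_upper_bound[OF D con T(1)] T(2) assms(3,4) by simp
  ultimately show ?thesis by simp
qed

end
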